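(* (Ribaucour congruences and surfaces with flat normal bundle in $S^{3,1}$.) Let $D\subset\mathbb R^2$ be open and simply connected with coordinates $(x,y)$, let $\varphi:D\to\mathbb R$ be smooth with $\sin\varphi\cos\varphi\ne0$, and let $(\kappa^1,s^1),(\kappa^2,s^2),(\kappa^3,s^3)$ be three smooth solutions on $D$ of the linear system $\kappa_x=\tan\varphi\,s_x$, $\kappa_y=-\cot\varphi\,s_y$, with $s^1_x\neq0$, $s^1_y\ne0$. Let $A,V^{31},V^{32}$ be functions on $D$ with $$dA=\kappa^1d\kappa^2+s^1ds^2,\quad dV^{31}=\kappa^3d\kappa^1+s^3ds^1,\quad dV^{32}=\kappa^3d\kappa^2+s^3ds^2,$$ and let $B=\frac12\big((\kappa^1)^2+(s^1)^2+1\big)$. Let $M^2\subset E^3$ be the surface with radius-vector and unit normal $${\bf r}=\begin{pmatrix}\kappa^2-\kappa^1A/B\\ s^2-s^1A/B\\ -A/B\end{pmatrix},\qquad {\bf n}=\begin{pmatrix}\kappa^1/B\\ s^1/B\\ 1/B-1\end{pmatrix},$$ whose radii of principal curvature are $\rho^1=\lambda^1B-A$, $\rho^2=\lambda^2B-A$, where $\lambda^1=s^2_x/s^1_x$, $\lambda^2=s^2_y/s^1_y$. Assume that ${\bf r}$ is an immersion, that $V^{31}\ne0$, and that $$R=\frac{V^{32}}{V^{31}}B-A$$ satisfies $R\neq0$, $R\neq\rho^1$, $R\ne\rho^2$ on $D$. Then: (i) the functions $P=V^{32}-V^{31}A/B$, $Q=V^{31}/B$ satisfy $P_x=\rho^1Q_x$,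 $P_y=\rho^2Q_y$, and $R=P/Q$; (ii) the congruence of spheres with centers ${\bf r}-R{\bf n}$ and radii $R$ is a Ribaucour congruence having $M^2$ as one of its envelopes; (iii) under the Lie correspondence this congruence gives a surface with flat normal bundle in $S^{3,1}$, with homogeneous hexaspherical coordinates $$z^1=\kappa^2-\kappa^1\tfrac{V^{32}}{V^{31}},\qquad z^2=s^2-s^1\tfrac{V^{32}}{V^{31}},\qquad z^3=(B-1)\tfrac{V^{32}}{V^{31}}-A,$$ $$z^4=\tfrac12\Big(1-(\kappa^2)^2-(s^2)^2+2(\kappa^1\kappa^2+s^1s^2-A)\tfrac{V^{32}}{V^{31}}\Big),$$ $$z^5=\tfrac12\Big(1+(\kappa^2)^2+(s^2)^2+2(A-\kappa^1\kappa^2-s^1s^2)\tfrac{V^{32}}{V^{31}}\Big),\qquad z^6=B\tfrac{V^{32}}{V^{31}}-A,$$ that is, the surface with radius-vector $(z^1/z^6,\dots,z^5/z^6)$.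
   Context: All functions are smooth. Superscripts on $\kappa,s,z,\rho,\lambda$ are indices, not powers; $(\kappa^2)^2$ is the square of $\kappa^2$. Radii of principal curvature follow the convention ${\bf r}_x=\rho^1{\bf n}_x$, ${\bf r}_y=\rho^2{\bf n}_y$, where $x,y$ are coordinates of the lines of curvature of $M^2$ (diagonalizing both the first and second fundamental forms). Given a surface $M^2\subset E^3$ with radius-vector ${\bf r}$ and unit normal ${\bf n}$ and a function $R(x,y)$, the spheres with centers ${\bf r}-R{\bf n}$ and radii $R$ are tangent to $M^2$ and form a congruence (two-parameter family) of spheres; besides $M^2$ it has another envelope $\tilde M^2$. The congruence is called a Ribaucour congruence if the lines of curvature on $M^2$ and $\tilde M^2$ correspond to each other, i.e. the coordinate lines of $x,y$ are lines of curvature also on $\tilde M^2$ (where $\tilde M^2$ is a regular surface). Lie correspondence: to a sphere of radius $R$ with center $\xi=(\xi^1,\xi^2,\xi^3)$ one associates the point of projective space $P^5$ with homogeneous (hexaspherical) coordinates $$z^1=\xi^1,\ z^2=\xi^2,\ z^3=\xi^3,\ z^4=\tfrac{1-(\xi,\xi)+R^2}{2},\ z^5=\tfrac{1+(\xi,\xi)-R^2}{2},\ z^6=R,$$ which satisfy $(z^1)^2+(z^2)^2+(z^3)^2+(z^4)^2-(z^5)^2-(z^6)^2=0$. With $\tilde z^i=z^i/z^6$, $i=1,\dots,5$, this is the quadric $S^{3,1}$: $(\tilde z^1)^2+(\tilde z^2)^2+(\tilde z^3)^2+(\tilde z^4)^2-(\tilde z^5)^2=1$ in the Lorentzian space with metric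 $(d\tilde z^1)^2+(d\tilde z^2)^2+(d\tilde z^3)^2+(d\tilde z^4)^2-(d\tilde z^5)^2$; $S^{3,1}$ carries the induced Lorentzian metric of constant curvature $1$. A (nondegenerate) surface in $S^{3,1}$ has flat normal bundle if the normal connection induced on its rank-2 normal bundle by the Levi-Civita connection of $S^{3,1}$ is flat. *)

theory Defs
  imports "HOL-Analysis.Analysis"
begin

definition partial_x :: "(real \<times> real \<Rightarrow> 'b::real_normed_vector) \<Rightarrow> real \<times> real \<Rightarrow> 'b"
    (\<open>\<partial>\<^sub>x\<close>) where
  "\<partial>\<^sub>x f p = frechet_derivative f (at p) (1, 0)"

definition partial_y :: "(real \<times> real \<Rightarrow> 'b::real_normed_vector) \<Rightarrow> real \<times> real \<Rightarrow> 'b"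
    (\<open>\<partial>\<^sub>y\<close>) where
  "\<partial>\<^sub>y f p = frechet_derivative f (at p) (0, 1)"

primrec Ck_on :: "nat \<Rightarrow> (real \<times> real) set \<Rightarrow> (real \<times> real \<Rightarrow> 'b::real_normed_vector) \<Rightarrow> bool"
  where
    "Ck_on 0 = (\<lambda>D f. continuous_on D f)"
  | "Ck_on (Suc k) = (\<lambda>D f. (\<forall>p\<in>D. f differentiable (at p)) \<and>
                          Ck_on k D (\<partial>\<^sub>x f) \<and> Ck_on k D (\<partial>\<^sub>y f))"

text \<open>Meant for open \<open>D\<close>.\<close>

definition smooth_on :: "(real \<times> real) set \<Rightarrow> (real \<times> real \<Rightarrow> 'b::real_normed_vector) \<Rightarrow> bool"
  where "smooth_on D f \<longleftrightarrow> (\<forall>k. Ck_on k D f)"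

definition is_solution ::
    "(real \<times> real) set \<Rightarrow> (real \<times> real \<Rightarrow> real) \<Rightarrow> (real \<times> real \<Rightarrow> real) \<Rightarrow>
     (real \<times> real \<Rightarrow> real) \<Rightarrow> bool" where
  "is_solution D \<phi> \<kappa> s \<longleftrightarrow> smooth_on D \<kappa> \<and> smooth_on D s \<and>
     (\<forall>p\<in>D. \<partial>\<^sub>x \<kappa> p = tan (\<phi> p) * \<partial>\<^sub>x s p \<and> \<partial>\<^sub>y \<kappa> p = - cot (\<phi> p) * \<partial>\<^sub>y s p)"

text \<open>\<open>dV = \<kappa> d\<kappa>' + s ds'\<close> on \<open>D\<close>.\<close>

definition is_potential ::
    "(real \<times> real) set \<Rightarrow> (real \<times> real \<Rightarrow> real) \<Rightarrow> (real \<times> real \<Rightarrow> real) \<Rightarrow>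
     (real \<times> real \<Rightarrow> real) \<Rightarrow> (real \<times> real \<Rightarrow> real) \<Rightarrow> (real \<times> real \<Rightarrow> real) \<Rightarrow> bool" where
  "is_potential D V \<kappa> \<kappa>' s s' \<longleftrightarrow> smooth_on D V \<and>
     (\<forall>p\<in>D. (V has_derivative
        (\<lambda>h. \<kappa> p * frechet_derivative \<kappa>' (at p) h + s p * frechet_derivative s' (at p) h)) (at p))"

definition immersed_at :: "(real \<times> real \<Rightarrow> real^3) \<Rightarrow> real \<times> real \<Rightarrow> bool" where
  "immersed_at X p \<longleftrightarrow> inj (frechet_derivative X (at p))"

definition unit_normal_on ::
    "(real \<times> real) set \<Rightarrow> (real \<times> real \<Rightarrow> real^3) \<Rightarrow> (real \<times> real \<Rightarrow> real^3) \<Rightarrow> bool" where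
  "unit_normal_on D X N \<longleftrightarrow> smooth_on D N \<and>
     (\<forall>p\<in>D. norm (N p) = 1 \<and> N p \<bullet> \<partial>\<^sub>x X p = 0 \<and> N p \<bullet> \<partial>\<^sub>y X p = 0)"

definition gauss_normal :: "(real \<times> real \<Rightarrow> real^3) \<Rightarrow> real \<times> real \<Rightarrow> real^3" where
  "gauss_normal X p = sgn (cross3 (\<partial>\<^sub>x X p) (\<partial>\<^sub>y X p))"

text \<open>The first and the second fundamental form are both diagonal in the coordinates at \<open>p\<close>.\<close>

definition curvature_coordinates_at :: "(real \<times> real \<Rightarrow> real^3) \<Rightarrow> real \<times> real \<Rightarrow> bool" where
  "curvature_coordinates_at X p \<longleftrightarrow> immersed_at X p \<and>
     \<partial>\<^sub>x X p \<bullet> \<partial>\<^sub>y X p = 0 \<and> \<partial>\<^sub>x (\<partial>\<^sub>y X) p \<bullet> gauss_normal X p = 0"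

text \<open>The sphere with centre \<open>c p\<close> and (signed) radius \<open>R p\<close> passes through \<open>X p\<close> and is
  tangent to \<open>X\<close> there. An envelope may have singular points.\<close>

definition envelope ::
    "(real \<times> real) set \<Rightarrow> (real \<times> real \<Rightarrow> real^3) \<Rightarrow> (real \<times> real \<Rightarrow> real) \<Rightarrow>
     (real \<times> real \<Rightarrow> real^3) \<Rightarrow> bool" where
  "envelope D c R X \<longleftrightarrow> smooth_on D X \<and>
     (\<forall>p\<in>D. norm (X p - c p) = \<bar>R p\<bar> \<and>
            (X p - c p) \<bullet> \<partial>\<^sub>x X p = 0 \<and> (X p - c p) \<bullet> \<partial>\<^sub>y X p = 0)"

definition second_envelope ::
    "(real \<times> real) set \<Rightarrow> (real \<times> real \<Rightarrow> real^3) \<Rightarrow> (real \<times> real \<Rightarrow> real) \<Rightarrow>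
     (real \<times> real \<Rightarrow> real^3) \<Rightarrow> (real \<times> real \<Rightarrow> real^3) \<Rightarrow> bool" where
  "second_envelope D c R X Y \<longleftrightarrow> envelope D c R Y \<and> (\<forall>p\<in>D. Y p \<noteq> X p)"

text \<open>The congruence with centres \<open>c\<close> and radii \<open>R\<close> is a Ribaucour congruence one of whose
  envelopes is the surface \<open>X\<close>.\<close>

definition ribaucour_congruence ::
    "(real \<times> real) set \<Rightarrow> (real \<times> real \<Rightarrow> real^3) \<Rightarrow> (real \<times> real \<Rightarrow> real) \<Rightarrow>
     (real \<times> real \<Rightarrow> real^3) \<Rightarrow> bool" where
  "ribaucour_congruence D c R X \<longleftrightarrow>
     envelope D c R X \<and> (\<forall>p\<in>D. curvature_coordinates_at X p) \<and>
     (\<exists>Y. second_envelope D c R X Y) \<and>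
     (\<forall>Y. second_envelope D c R X Y \<longrightarrow>
        (\<forall>p\<in>D. immersed_at Y p \<longrightarrow> curvature_coordinates_at Y p))"

definition hexaspherical :: "real^3 \<Rightarrow> real \<Rightarrow> real^6" where
  "hexaspherical \<xi> R =
     vector [\<xi> $ 1, \<xi> $ 2, \<xi> $ 3, (1 - \<xi> \<bullet> \<xi> + R\<^sup>2) / 2, (1 + \<xi> \<bullet> \<xi> - R\<^sup>2) / 2, R]"

definition affine_chart :: "real^6 \<Rightarrow> real^5" where
  "affine_chart z = vector [z $ 1 / z $ 6, z $ 2 / z $ 6, z $ 3 / z $ 6, z $ 4 / z $ 6, z $ 5 / z $ 6]"

definition lorentz :: "real^5 \<Rightarrow> real^5 \<Rightarrow> real" where
  "lorentz u v = u $ 1 * v $ 1 + u $ 2 * v $ 2 + u $ 3 * v $ 3 + u $ 4 * v $ 4 - u $ 5 * v $ 5"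

definition S31 :: "(real^5) set" where
  "S31 = {u. lorentz u u = 1}"

definition nondegenerate_surface :: "(real \<times> real) set \<Rightarrow> (real \<times> real \<Rightarrow> real^5) \<Rightarrow> bool" where
  "nondegenerate_surface D F \<longleftrightarrow> smooth_on D F \<and> F ` D \<subseteq> S31 \<and>
     (\<forall>p\<in>D. lorentz (\<partial>\<^sub>x F p) (\<partial>\<^sub>x F p) * lorentz (\<partial>\<^sub>y F p) (\<partial>\<^sub>y F p)
              - (lorentz (\<partial>\<^sub>x F p) (\<partial>\<^sub>y F p))\<^sup>2 \<noteq> 0)"

text \<open>The normal space of the surface inside the tangent space of \<open>S31\<close>; the latter is the
  Lorentz-orthogonal complement of the position vector.\<close>

definition normal_space :: "(real \<times> real \<Rightarrow> real^5) \<Rightarrow> real \<times> real \<Rightarrow> (real^5) set" where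
  "normal_space F p =
     {v. lorentz v (F p) = 0 \<and> lorentz v (\<partial>\<^sub>x F p) = 0 \<and> lorentz v (\<partial>\<^sub>y F p) = 0}"

text \<open>Uniquely determined for \<open>v\<close> tangent to \<open>S31\<close> when the surface is nondegenerate.\<close>

definition normal_component ::
    "(real \<times> real \<Rightarrow> real^5) \<Rightarrow> real \<times> real \<Rightarrow> real^5 \<Rightarrow> real^5" where
  "normal_component F p v =
     (THE u. u \<in> normal_space F p \<and> v - u \<in> span {\<partial>\<^sub>x F p, \<partial>\<^sub>y F p})"

text \<open>The Levi-Civita connection of \<open>S31\<close> is the flat connection of the ambient Lorentzian space
  followed by the orthogonal projection to the tangent space of \<open>S31\<close>.\<close>

definition S31_tangent_part :: "real^5 \<Rightarrow> real^5 \<Rightarrow> real^5" where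
  "S31_tangent_part q v = v - lorentz v q *\<^sub>R q"

definition normal_connection_x ::
    "(real \<times> real \<Rightarrow> real^5) \<Rightarrow> (real \<times> real \<Rightarrow> real^5) \<Rightarrow> real \<times> real \<Rightarrow> real^5" where
  "normal_connection_x F \<xi> p = normal_component F p (S31_tangent_part (F p) (\<partial>\<^sub>x \<xi> p))"

definition normal_connection_y ::
    "(real \<times> real \<Rightarrow> real^5) \<Rightarrow> (real \<times> real \<Rightarrow> real^5) \<Rightarrow> real \<times> real \<Rightarrow> real^5" where
  "normal_connection_y F \<xi> p = normal_component F p (S31_tangent_part (F p) (\<partial>\<^sub>y \<xi> p))"

text \<open>The curvature \<open>R(\<partial>\<^sub>x, \<partial>\<^sub>y) \<xi>\<close>; the bracket term vanishes for coordinate fields.\<close>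

definition normal_curvature ::
    "(real \<times> real \<Rightarrow> real^5) \<Rightarrow> (real \<times> real \<Rightarrow> real^5) \<Rightarrow> real \<times> real \<Rightarrow> real^5" where
  "normal_curvature F \<xi> p =
     normal_connection_x F (normal_connection_y F \<xi>) p
     - normal_connection_y F (normal_connection_x F \<xi>) p"

definition flat_normal_bundle :: "(real \<times> real) set \<Rightarrow> (real \<times> real \<Rightarrow> real^5) \<Rightarrow> bool" where
  "flat_normal_bundle D F \<longleftrightarrow>
     (\<forall>\<xi>. smooth_on D \<xi> \<and> (\<forall>p\<in>D. \<xi> p \<in> normal_space F p) \<longrightarrow>
        (\<forall>p\<in>D. normal_curvature F \<xi> p = 0))"

end

theory Submission
  imports Defs
begin

text \<open>
  Write \<open>U\<^sub>i = (\<kappa>\<^sup>i, s\<^sup>i, 0)\<close>. The linear system says that \<open>\<partial>\<^sub>x U\<^sub>i\<close> and \<open>\<partial>\<^sub>y U\<^sub>i\<close> are multiples of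
  \<open>\<partial>\<^sub>x U\<^sub>1\<close> and \<open>\<partial>\<^sub>y U\<^sub>1\<close>, which are orthogonal to each other. Hence \<open>r\<close> and the surface \<open>M\<close>
  with the same Gauss map \<open>n\<close> and with support function \<open>Q\<close> have partial derivatives parallel to those of \<open>n\<close>.
  The vector \<open>M\<close> is orthogonal to the surface of centres, so the second envelope is
  \<open>r - (2P / |M|\<^sup>2) M\<close>, with normal the reflection of \<open>n\<close> in the plane \<open>M\<^sup>\<bottom>\<close>; the partial derivatives
  of both are multiples of the reflected partial derivatives of \<open>n\<close>, so the coordinate lines are
  again lines of curvature.

  For the Lie image \<open>F\<close>, the coordinate lines are orthogonal and, in addition, the mixed derivative
  \<open>F\<^sub>x\<^sub>y\<close> is orthogonal to the normal space. Therefore the shape operators are all diagonal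
  in the coordinates, and the Ricci equation gives a flat normal connection.
\<close>

section \<open>Partial derivatives and smoothness\<close>

text \<open>Put \<open>N = n + k\<close>. If \<open>dU = l dU1\<close> along a coordinate and
  \<open>da = U1 . dU\<close>, then \<open>U - a N\<close> has derivative
  \<open>(l B - a) dn\<close> along it. The pair \<open>(U2, A)\<close> gives \<open>r\<close>. For
  \<open>U3\<close> a potential of \<open>U1 . dU3\<close> is required, and integration by parts
  supplies \<open>U1 . U3 - V31\<close>; this is the origin of \<open>M\<close>. That
  \<open>M\<close> is orthogonal to the surface of centres is the relation between \<open>dP\<close>
  and \<open>dQ\<close>, read through \<open>P = R Q\<close> and \<open>Q = M . n\<close>.

  The delicate point is the mixed derivative of \<open>F\<close>, because a given vector
  \<open>w\<close> is normal at one point only. With \<open>v = V32 / V31\<close> the hexaspherical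
  coordinates are affine in \<open>v\<close>, so \<open>R\<close> times the pairing of
  \<open>w\<close> with \<open>F\<close> has the form \<open>e2 - v e\<close>, and the partials of
  \<open>e2\<close> are \<open>l1\<close> and \<open>l2\<close> times those of \<open>e\<close>,
  exactly as for \<open>V32\<close> and \<open>V31\<close>. Since \<open>V32 - v V31 = 0\<close>
  identically, a multiple of it can be subtracted, with the factor \<open>m = e / V31\<close> taken
  at the point; then \<open>e - m V31\<close> vanishes there together with its gradient and its
  mixed derivative.\<close>

lemma partial_eqI:
  assumes "(f has_derivative f') (at p)"
  shows "\<partial>\<^sub>x f p = f' (1, 0)" "\<partial>\<^sub>y f p = f' (0, 1)"
  using frechet_derivative_at[OF assms] by (simp_all add: partial_x_def partial_y_def)

lemma frechet_derivative_partials: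
  assumes "f differentiable (at p)"
  shows "frechet_derivative f (at p) h = fst h *\<^sub>R \<partial>\<^sub>x f p + snd h *\<^sub>R \<partial>\<^sub>y f p"
proof -
  interpret linear "frechet_derivative f (at p)"
    using assms by (rule linear_frechet_derivative)
  have "h = fst h *\<^sub>R (1, 0) + snd h *\<^sub>R (0, 1)"
    by (simp add: prod_eq_iff)
  then have "frechet_derivative f (at p) h =
      frechet_derivative f (at p) (fst h *\<^sub>R (1, 0) + snd h *\<^sub>R (0, 1))"
    by (rule arg_cong)
  then show ?thesis
    by (simp only: add scale partial_x_def partial_y_def)
qed

lemma has_derivative_partials:
  assumes "f differentiable (at p)"
  shows "(f has_derivative (\<lambda>h. fst h *\<^sub>R \<partial>\<^sub>x f p + snd h *\<^sub>R \<partial>\<^sub>y f p)) (at p)"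
  using assms unfolding frechet_derivative_works
  by (simp add: frechet_derivative_partials[OF assms, abs_def])

text \<open>No differentiability is assumed: the two functions have the same derivatives at
  \<open>p\<close>, if any, so the choice operator in \<open>frechet_derivative\<close> picks the
  same map for both.\<close>

lemma partial_cong:
  assumes "open D" "p \<in> D" "\<And>q. q \<in> D \<Longrightarrow> f q = g q"
  shows "\<partial>\<^sub>x f p = \<partial>\<^sub>x g p" "\<partial>\<^sub>y f p = \<partial>\<^sub>y g p"
proof -
  have "(f has_derivative f') (at p) \<longleftrightarrow> (g has_derivative f') (at p)" for f'
    using has_derivative_transform_within_open[of f f' p UNIV D g]
      has_derivative_transform_within_open[of g f' p UNIV D f] assms by auto
  then have "frechet_derivative f (at p) = frechet_derivative g (at p)"
    by (simp add: frechet_derivative_def)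
  then show "\<partial>\<^sub>x f p = \<partial>\<^sub>x g p" "\<partial>\<^sub>y f p = \<partial>\<^sub>y g p"
    by (simp_all add: partial_x_def partial_y_def)
qed

lemma differentiable_cong_open:
  assumes "open D" "p \<in> D" "\<And>q. q \<in> D \<Longrightarrow> f q = g q" "f differentiable (at p)"
  shows "g differentiable (at p)"
  using has_derivative_transform_within_open[of f _ p UNIV D g] assms unfolding differentiable_def
  by auto

lemma partial_const [simp]: "\<partial>\<^sub>x (\<lambda>q. c) p = 0" "\<partial>\<^sub>y (\<lambda>q. c) p = 0"
  by (simp_all add: partial_x_def partial_y_def)

lemma partial_linear:
  assumes "bounded_linear L" "f differentiable (at p)"
  shows "\<partial>\<^sub>x (\<lambda>q. L (f q)) p = L (\<partial>\<^sub>x f p)" "\<partial>\<^sub>y (\<lambda>q. L (f q)) p = L (\<partial>\<^sub>y f p)"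
  using partial_eqI[OF bounded_linear.has_derivative[OF assms(1) has_derivative_partials[OF assms(2)]]]
  by simp_all

lemma partial_bilinear:
  assumes "bounded_bilinear m" "f differentiable (at p)" "g differentiable (at p)"
  shows "\<partial>\<^sub>x (\<lambda>q. m (f q) (g q)) p = m (f p) (\<partial>\<^sub>x g p) + m (\<partial>\<^sub>x f p) (g p)"
    "\<partial>\<^sub>y (\<lambda>q. m (f q) (g q)) p = m (f p) (\<partial>\<^sub>y g p) + m (\<partial>\<^sub>y f p) (g p)"
  using partial_eqI[OF bounded_bilinear.FDERIV[OF assms(1)
        has_derivative_partials[OF assms(2)] has_derivative_partials[OF assms(3)]]]
  by simp_all

lemmas partial_mult = partial_bilinear[OF bounded_bilinear_mult]
lemmas partial_inner = partial_bilinear[OF bounded_bilinear_inner]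
lemmas partial_scaleR = partial_bilinear[OF bounded_bilinear_scaleR]
lemmas partial_nth = partial_linear[OF bounded_linear_vec_nth]

lemma partial_add:
  assumes "f differentiable (at p)" "g differentiable (at p)"
  shows "\<partial>\<^sub>x (\<lambda>q. f q + g q) p = \<partial>\<^sub>x f p + \<partial>\<^sub>x g p" "\<partial>\<^sub>y (\<lambda>q. f q + g q) p = \<partial>\<^sub>y f p + \<partial>\<^sub>y g p"
  using partial_eqI[OF has_derivative_add[OF has_derivative_partials[OF assms(1)]
        has_derivative_partials[OF assms(2)]]]
  by simp_all

lemma partial_diff:
  assumes "f differentiable (at p)" "g differentiable (at p)"
  shows "\<partial>\<^sub>x (\<lambda>q. f q - g q) p = \<partial>\<^sub>x f p - \<partial>\<^sub>x g p" "\<partial>\<^sub>y (\<lambda>q. f q - g q) p = \<partial>\<^sub>y f p - \<partial>\<^sub>y g p"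
  using partial_eqI[OF has_derivative_diff[OF has_derivative_partials[OF assms(1)]
        has_derivative_partials[OF assms(2)]]]
  by simp_all

lemma partial_inverse:
  fixes f :: "real \<times> real \<Rightarrow> real"
  assumes "f differentiable (at p)" "f p \<noteq> 0"
  shows "\<partial>\<^sub>x (\<lambda>q. inverse (f q)) p = - (inverse (f p) * inverse (f p) * \<partial>\<^sub>x f p)"
    "\<partial>\<^sub>y (\<lambda>q. inverse (f q)) p = - (inverse (f p) * inverse (f p) * \<partial>\<^sub>y f p)"
  using partial_eqI[OF Deriv.has_derivative_inverse[OF assms(2) has_derivative_partials[OF assms(1)]]]
  by simp_all

section \<open>Closure of k-fold differentiability and of smoothness under the algebraic
  operations\<close>

lemma Ck_on_cong:
  assumes "open D"
  shows "(\<And>q. q \<in> D \<Longrightarrow> f q = g q) \<Longrightarrow> Ck_on k D f \<Longrightarrow> Ck_on k D g"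
proof (induction k arbitrary: f g)
  case 0
  then show ?case using continuous_on_cong[of D D f g] by simp
next
  case (Suc k)
  have "Ck_on k D (\<partial>\<^sub>x g)" "Ck_on k D (\<partial>\<^sub>y g)"
    using Suc.IH[of "\<partial>\<^sub>x f" "\<partial>\<^sub>x g"] Suc.IH[of "\<partial>\<^sub>y f" "\<partial>\<^sub>y g"] Suc.prems
      partial_cong[OF assms, of _ f g] by auto
  moreover have "g differentiable (at p)" if "p \<in> D" for p
    using Suc.prems(2) that
    by (intro differentiable_cong_open[OF assms that Suc.prems(1)]) simp_all
  ultimately show ?case
    by simp
qed

lemma Ck_on_SucD: "Ck_on (Suc k) D f \<Longrightarrow> Ck_on k D f"
proof (induction k arbitrary: f)
  case 0
  then show ?case
    by (auto intro!: continuous_at_imp_continuous_on differentiable_imp_continuous_within)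
next
  case (Suc k)
  from Suc.prems have d: "\<forall>p\<in>D. f differentiable (at p)"
    and x: "Ck_on (Suc k) D (\<partial>\<^sub>x f)" and y: "Ck_on (Suc k) D (\<partial>\<^sub>y f)"
    by simp_all
  from d Suc.IH[OF x] Suc.IH[OF y] show ?case
    by simp
qed

lemma Ck_on_const: "Ck_on k D (\<lambda>q. c)"
proof (induction k arbitrary: c)
  case (Suc k)
  have "\<partial>\<^sub>x (\<lambda>q. c) = (\<lambda>q. 0)" "\<partial>\<^sub>y (\<lambda>q. c) = (\<lambda>q. 0)"
    by (simp_all add: fun_eq_iff)
  then show ?case using Suc by simp
qed simp

lemma Ck_on_add:
  assumes "open D"
  shows "Ck_on k D f \<Longrightarrow> Ck_on k D g \<Longrightarrow> Ck_on k D (\<lambda>q. f q + g q)"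
proof (induction k arbitrary: f g)
  case 0
  then show ?case by (simp add: continuous_on_add)
next
  case (Suc k)
  \<comment> \<open>The sum rule is available only at points of \<open>D\<close>, where both
    summands are differentiable; \<open>Ck_on_cong\<close> carries the regularity of its right-hand
    side over to the derivative. The same pattern recurs for products, linear maps and
    inverses.\<close>
  have "Ck_on k D (\<partial>\<^sub>x (\<lambda>q. f q + g q))"
    by (rule Ck_on_cong[OF assms _ Suc.IH[of "\<partial>\<^sub>x f" "\<partial>\<^sub>x g"]],
        use Suc.prems in \<open>auto simp: partial_add\<close>)
  moreover have "Ck_on k D (\<partial>\<^sub>y (\<lambda>q. f q + g q))"
    by (rule Ck_on_cong[OF assms _ Suc.IH[of "\<partial>\<^sub>y f" "\<partial>\<^sub>y g"]],
        use Suc.prems in \<open>auto simp: partial_add\<close>)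
  ultimately show ?case using Suc.prems by (simp add: differentiable_add)
qed

lemma differentiable_bilinear:
  assumes "bounded_bilinear m" "f differentiable (at p)" "g differentiable (at p)"
  shows "(\<lambda>q. m (f q) (g q)) differentiable (at p)"
  using bounded_bilinear.FDERIV[OF assms(1)] assms(2,3) unfolding differentiable_def by blast

lemma Ck_on_bilinear:
  assumes "open D" "bounded_bilinear m"
  shows "Ck_on k D f \<Longrightarrow> Ck_on k D g \<Longrightarrow> Ck_on k D (\<lambda>q. m (f q) (g q))"
proof (induction k arbitrary: f g)
  case 0
  then show ?case by (simp add: bounded_bilinear.continuous_on[OF assms(2)])
next
  case (Suc k)
  \<comment> \<open>Each term of the Leibniz rule keeps one factor undifferentiated, and that factor
    enters one order below the given one.\<close>
  have fg: "Ck_on k D f" "Ck_on k D g"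
    using Suc.prems Ck_on_SucD by blast+
  have "Ck_on k D (\<lambda>q. m (f q) (\<partial>\<^sub>x g q) + m (\<partial>\<^sub>x f q) (g q))"
    using Suc.prems fg by (intro Ck_on_add[OF assms(1)] Suc.IH) auto
  then have "Ck_on k D (\<partial>\<^sub>x (\<lambda>q. m (f q) (g q)))"
    using Suc.prems by (elim Ck_on_cong[OF assms(1), rotated]) (auto simp: partial_bilinear[OF assms(2)])
  moreover have "Ck_on k D (\<lambda>q. m (f q) (\<partial>\<^sub>y g q) + m (\<partial>\<^sub>y f q) (g q))"
    using Suc.prems fg by (intro Ck_on_add[OF assms(1)] Suc.IH) auto
  then have "Ck_on k D (\<partial>\<^sub>y (\<lambda>q. m (f q) (g q)))"
    using Suc.prems by (elim Ck_on_cong[OF assms(1), rotated]) (auto simp: partial_bilinear[OF assms(2)])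
  ultimately show ?case using Suc.prems by (auto intro: differentiable_bilinear[OF assms(2)])
qed

lemma Ck_on_linear:
  assumes "open D" "bounded_linear L"
  shows "Ck_on k D f \<Longrightarrow> Ck_on k D (\<lambda>q. L (f q))"
proof (induction k arbitrary: f)
  case 0
  then show ?case by (simp add: bounded_linear.continuous_on[OF assms(2)])
next
  case (Suc k)
  have "Ck_on k D (\<partial>\<^sub>x (\<lambda>q. L (f q)))"
    by (rule Ck_on_cong[OF assms(1) _ Suc.IH[of "\<partial>\<^sub>x f"]],
        use Suc.prems in \<open>auto simp: partial_linear[OF assms(2)]\<close>)
  moreover have "Ck_on k D (\<partial>\<^sub>y (\<lambda>q. L (f q)))"
    by (rule Ck_on_cong[OF assms(1) _ Suc.IH[of "\<partial>\<^sub>y f"]],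
        use Suc.prems in \<open>auto simp: partial_linear[OF assms(2)]\<close>)
  moreover have "(\<lambda>q. L (f q)) differentiable (at p)" if "p \<in> D" for p
    using Suc.prems that bounded_linear.has_derivative[OF assms(2) has_derivative_partials[of f p]]
    unfolding differentiable_def[of "\<lambda>q. L (f q)"] by simp blast
  ultimately show ?case by simp
qed

lemma Ck_on_inverse:
  fixes f :: "real \<times> real \<Rightarrow> real"
  assumes "open D" and nz: "\<And>q. q \<in> D \<Longrightarrow> f q \<noteq> 0"
  shows "Ck_on k D f \<Longrightarrow> Ck_on k D (\<lambda>q. inverse (f q))"
proof (induction k)
  case 0
  then show ?case using nz by (auto intro!: continuous_on_inverse)
next
  case (Suc k)
  have i: "Ck_on k D (\<lambda>q. inverse (f q))"
    using Suc Ck_on_SucD by blast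
  have c: "Ck_on k D (\<lambda>q. - (inverse (f q) * inverse (f q) * g q))" if "Ck_on k D g" for g
    by (intro Ck_on_linear[OF assms(1) bounded_linear_minus[OF bounded_linear_ident]]
        Ck_on_bilinear[OF assms(1) bounded_bilinear_mult] i that)
  have "Ck_on k D (\<partial>\<^sub>x (\<lambda>q. inverse (f q)))"
    by (rule Ck_on_cong[OF assms(1) _ c[of "\<partial>\<^sub>x f"]],
        use Suc.prems nz in \<open>auto simp: partial_inverse\<close>)
  moreover have "Ck_on k D (\<partial>\<^sub>y (\<lambda>q. inverse (f q)))"
    by (rule Ck_on_cong[OF assms(1) _ c[of "\<partial>\<^sub>y f"]],
        use Suc.prems nz in \<open>auto simp: partial_inverse\<close>)
  ultimately show ?case using Suc.prems nz by (simp add: differentiable_inverse)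
qed

lemma smooth_on_differentiable: "smooth_on D f \<Longrightarrow> p \<in> D \<Longrightarrow> f differentiable (at p)"
  unfolding smooth_on_def by (drule spec[of _ 1]) simp

lemma smooth_on_continuous: "smooth_on D f \<Longrightarrow> continuous_on D f"
  unfolding smooth_on_def by (drule spec[of _ 0]) simp

lemma smooth_on_partial:
  assumes "smooth_on D f"
  shows "smooth_on D (\<partial>\<^sub>x f)" "smooth_on D (\<partial>\<^sub>y f)"
proof -
  have "Ck_on (Suc k) D f" for k
    using assms by (simp only: smooth_on_def)
  then show "smooth_on D (\<partial>\<^sub>x f)" "smooth_on D (\<partial>\<^sub>y f)"
    by (simp_all add: smooth_on_def)
qed

lemma smooth_on_const: "smooth_on D (\<lambda>q. c)"
  by (simp add: smooth_on_def Ck_on_const)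

lemma smooth_on_add: "open D \<Longrightarrow> smooth_on D f \<Longrightarrow> smooth_on D g \<Longrightarrow> smooth_on D (\<lambda>q. f q + g q)"
  by (simp add: smooth_on_def Ck_on_add)

lemma smooth_on_linear:
  "open D \<Longrightarrow> bounded_linear L \<Longrightarrow> smooth_on D f \<Longrightarrow> smooth_on D (\<lambda>q. L (f q))"
  by (simp add: smooth_on_def Ck_on_linear)

lemmas smooth_on_nth = smooth_on_linear[OF _ bounded_linear_vec_nth]
lemmas smooth_on_minus = smooth_on_linear[OF _ bounded_linear_minus[OF bounded_linear_ident]]

lemma smooth_on_diff: "open D \<Longrightarrow> smooth_on D f \<Longrightarrow> smooth_on D g \<Longrightarrow> smooth_on D (\<lambda>q. f q - g q)"
  using smooth_on_add[of D f "\<lambda>q. - g q"] smooth_on_minus[of D g] by simp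

lemma smooth_on_bilinear:
  "open D \<Longrightarrow> bounded_bilinear m \<Longrightarrow> smooth_on D f \<Longrightarrow> smooth_on D g \<Longrightarrow>
    smooth_on D (\<lambda>q. m (f q) (g q))"
  by (simp add: smooth_on_def Ck_on_bilinear)

lemmas smooth_on_mult = smooth_on_bilinear[OF _ bounded_bilinear_mult]
lemmas smooth_on_inner = smooth_on_bilinear[OF _ bounded_bilinear_inner]
lemmas smooth_on_scaleR = smooth_on_bilinear[OF _ bounded_bilinear_scaleR]

lemma smooth_on_inverse:
  fixes f :: "real \<times> real \<Rightarrow> real"
  assumes "open D" "smooth_on D f" "\<And>q. q \<in> D \<Longrightarrow> f q \<noteq> 0"
  shows "smooth_on D (\<lambda>q. inverse (f q))"
  using assms by (simp add: smooth_on_def Ck_on_inverse)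

lemma smooth_on_divide:
  fixes f g :: "real \<times> real \<Rightarrow> real"
  assumes "open D" "smooth_on D f" "smooth_on D g" "\<And>q. q \<in> D \<Longrightarrow> g q \<noteq> 0"
  shows "smooth_on D (\<lambda>q. f q / g q)"
  unfolding divide_inverse by (intro smooth_on_mult smooth_on_inverse assms)

lemma smooth_on_power2:
  fixes f :: "real \<times> real \<Rightarrow> real"
  assumes "open D" "smooth_on D f"
  shows "smooth_on D (\<lambda>q. (f q)\<^sup>2)"
  unfolding power2_eq_square by (intro smooth_on_mult assms)

lemma smooth_on_sum:
  assumes "open D" "\<And>i. i \<in> S \<Longrightarrow> smooth_on D (f i)"
  shows "smooth_on D (\<lambda>q. \<Sum>i\<in>S. f i q)"
  using assms(2)
proof (induction S rule: infinite_finite_induct)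
  case (insert x F)
  then show ?case by (simp add: smooth_on_add[OF assms(1)])
qed (simp_all add: smooth_on_const)

lemma smooth_on_vec:
  fixes f :: "real \<times> real \<Rightarrow> real^'n"
  assumes "open D" "\<And>i. smooth_on D (\<lambda>q. f q $ i)"
  shows "smooth_on D f"
proof -
  have "smooth_on D (\<lambda>q. \<Sum>i\<in>UNIV. f q $ i *\<^sub>R axis i (1::real))"
    by (intro smooth_on_sum smooth_on_scaleR smooth_on_const assms)
  moreover have "(\<Sum>i\<in>UNIV. f q $ i *\<^sub>R axis i (1::real)) = f q" for q
    using basis_expansion[of "f q"] by (simp add: scalar_mult_eq_scaleR)
  ultimately show ?thesis by simp
qed

lemmas smooth_intros = smooth_on_const smooth_on_add smooth_on_diff smooth_on_minus smooth_on_mult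
  smooth_on_inner smooth_on_scaleR smooth_on_divide smooth_on_power2 smooth_on_partial

lemma partial_divide:
  fixes f g :: "real \<times> real \<Rightarrow> real"
  assumes "f differentiable (at p)" "g differentiable (at p)" "g p \<noteq> 0"
  shows "\<partial>\<^sub>x (\<lambda>q. f q / g q) p = (\<partial>\<^sub>x f p * g p - f p * \<partial>\<^sub>x g p) / (g p * g p)"
    "\<partial>\<^sub>y (\<lambda>q. f q / g q) p = (\<partial>\<^sub>y f p * g p - f p * \<partial>\<^sub>y g p) / (g p * g p)"
proof -
  have i: "(\<lambda>q. inverse (g q)) differentiable (at p)"
    using assms(2,3) by (rule differentiable_inverse)
  show "\<partial>\<^sub>x (\<lambda>q. f q / g q) p = (\<partial>\<^sub>x f p * g p - f p * \<partial>\<^sub>x g p) / (g p * g p)"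
    "\<partial>\<^sub>y (\<lambda>q. f q / g q) p = (\<partial>\<^sub>y f p * g p - f p * \<partial>\<^sub>y g p) / (g p * g p)"
    unfolding divide_inverse partial_mult[OF assms(1) i] partial_inverse[OF assms(2,3)]
    using assms(3) by (simp_all add: divide_simps)
qed

text \<open>The second difference \<open>\<Delta> k\<close> over the square with corner
  \<open>p\<close> and side \<open>h k\<close> equals the square of \<open>h k\<close> times either
  mixed derivative at some interior point, by the mean value theorem applied in the two orders.
  Continuity of the mixed derivatives gives equality as the squares shrink.\<close>

lemma partial_symmetric_real:
  fixes f :: "real \<times> real \<Rightarrow> real"
  assumes D: "open D" and f: "smooth_on D f" and p: "p \<in> D"
  shows "\<partial>\<^sub>y (\<partial>\<^sub>x f) p = \<partial>\<^sub>x (\<partial>\<^sub>y f) p"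
proof -
  obtain a b where ab: "p = (a, b)" by fastforce
  have dx: "((\<lambda>t. g (t, y)) has_real_derivative \<partial>\<^sub>x g (x, y)) (at x)"
    if "smooth_on D g" "(x, y) \<in> D" for g x y
  proof -
    have "((\<lambda>t. g (t, y)) has_derivative
        (\<lambda>h. fst (h, 0::real) *\<^sub>R \<partial>\<^sub>x g (x, y) + snd (h, 0::real) *\<^sub>R \<partial>\<^sub>y g (x, y))) (at x)"
      by (rule has_derivative_compose[of "\<lambda>t. (t, y)" "\<lambda>h. (h, 0)" _ _ g])
        (auto intro!: derivative_eq_intros has_derivative_partials[OF smooth_on_differentiable[OF that],
            unfolded real_scaleR_def])
    then show ?thesis by (simp add: has_field_derivative_def mult_commute_abs)
  qed
  have dy: "((\<lambda>t. g (x, t)) has_real_derivative \<partial>\<^sub>y g (x, y)) (at y)"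
    if "smooth_on D g" "(x, y) \<in> D" for g x y
  proof -
    have "((\<lambda>t. g (x, t)) has_derivative
        (\<lambda>h. fst (0::real, h) *\<^sub>R \<partial>\<^sub>x g (x, y) + snd (0::real, h) *\<^sub>R \<partial>\<^sub>y g (x, y))) (at y)"
      by (rule has_derivative_compose[of "\<lambda>t. (x, t)" "\<lambda>h. (0, h)" _ _ g])
        (auto intro!: derivative_eq_intros has_derivative_partials[OF smooth_on_differentiable[OF that],
            unfolded real_scaleR_def])
    then show ?thesis by (simp add: has_field_derivative_def mult_commute_abs)
  qed
  note sp = smooth_on_partial[OF f]
  have lim: "(\<lambda>k. g (X k, Y k)) \<longlonglongrightarrow> g (a, b)"
    if "smooth_on D g" "X \<longlonglongrightarrow> a" "Y \<longlonglongrightarrow> b" for g :: "real \<times> real \<Rightarrow> real" and X Y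
  proof -
    have "isCont g (a, b)"
      using smooth_on_continuous[OF that(1)] D p ab by (simp add: continuous_on_eq_continuous_at)
    then show ?thesis
      by (rule isCont_tendsto_compose) (intro tendsto_Pair that)
  qed
  obtain d where d: "d > 0" "\<And>x y. \<bar>x - a\<bar> \<le> d \<Longrightarrow> \<bar>y - b\<bar> \<le> d \<Longrightarrow> (x, y) \<in> D"
  proof -
    obtain e where e: "e > 0" "ball p e \<subseteq> D" using D p open_contains_ball by blast
    \<comment> \<open>A third of the radius, because the closed square has to fit into the open
      ball: the two deviations add up to at most \<open>2 * e / 3\<close>.\<close>
    have "(x, y) \<in> D" if "\<bar>x - a\<bar> \<le> e / 3" "\<bar>y - b\<bar> \<le> e / 3" for x y
    proof -
      have "dist p (x, y) \<le> \<bar>x - a\<bar> + \<bar>y - b\<bar>"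
        unfolding ab dist_Pair_Pair dist_real_def
        by (rule order_trans[OF sqrt_sum_squares_le_sum_abs]) (simp add: abs_minus_commute)
      then have "dist p (x, y) < e" using that e(1) by linarith
      then show ?thesis using e(2) by auto
    qed
    then show ?thesis using that[of "e/3"] e(1) by simp
  qed
  define h where "h k = d / real (Suc k)" for k
  have h: "h k > 0" "h k \<le> d" for k
    using d(1) by (auto simp: h_def field_simps)
  have h0: "h \<longlonglongrightarrow> 0"
    unfolding h_def by (rule LIMSEQ_Suc[OF lim_const_over_n])
  define \<Delta> where "\<Delta> k = f (a + h k, b + h k) - f (a + h k, b) - f (a, b + h k) + f (a, b)" for k
  have 1: "\<exists>x y. a < x \<and> x < a + h k \<and> b < y \<and> y < b + h k \<and> \<Delta> k = h k * (h k * \<partial>\<^sub>y (\<partial>\<^sub>x f) (x, y))" for k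
  proof -
    have "\<exists>x>a. x < a + h k \<and> (f (a + h k, b + h k) - f (a + h k, b)) - (f (a, b + h k) - f (a, b)) =
        (a + h k - a) * (\<partial>\<^sub>x f (x, b + h k) - \<partial>\<^sub>x f (x, b))"
      using h[of k] d(1)
      by (intro MVT2[of a "a + h k" "\<lambda>x. f (x, b + h k) - f (x, b)"] DERIV_diff dx[OF f] d(2)) auto
    then obtain x where x: "a < x" "x < a + h k"
      "\<Delta> k = h k * (\<partial>\<^sub>x f (x, b + h k) - \<partial>\<^sub>x f (x, b))"
      by (auto simp: \<Delta>_def)
    have "\<exists>y>b. y < b + h k \<and> \<partial>\<^sub>x f (x, b + h k) - \<partial>\<^sub>x f (x, b) = (b + h k - b) * \<partial>\<^sub>y (\<partial>\<^sub>x f) (x, y)"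
      using h[of k] d(1) x
      by (intro MVT2[of b "b + h k" "\<lambda>y. \<partial>\<^sub>x f (x, y)"] dy[OF sp(1)] d(2)) auto
    then show ?thesis using x by auto
  qed
  have 2: "\<exists>x y. a < x \<and> x < a + h k \<and> b < y \<and> y < b + h k \<and> \<Delta> k = h k * (h k * \<partial>\<^sub>x (\<partial>\<^sub>y f) (x, y))" for k
  proof -
    have "\<exists>y>b. y < b + h k \<and> (f (a + h k, b + h k) - f (a, b + h k)) - (f (a + h k, b) - f (a, b)) =
        (b + h k - b) * (\<partial>\<^sub>y f (a + h k, y) - \<partial>\<^sub>y f (a, y))"
      using h[of k] d(1)
      by (intro MVT2[of b "b + h k" "\<lambda>y. f (a + h k, y) - f (a, y)"] DERIV_diff dy[OF f] d(2)) auto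
    then obtain y where y: "b < y" "y < b + h k"
      "\<Delta> k = h k * (\<partial>\<^sub>y f (a + h k, y) - \<partial>\<^sub>y f (a, y))"
      by (auto simp: \<Delta>_def)
    have "\<exists>x>a. x < a + h k \<and> \<partial>\<^sub>y f (a + h k, y) - \<partial>\<^sub>y f (a, y) = (a + h k - a) * \<partial>\<^sub>x (\<partial>\<^sub>y f) (x, y)"
      using h[of k] d(1) y
      by (intro MVT2[of a "a + h k" "\<lambda>x. \<partial>\<^sub>y f (x, y)"] dx[OF sp(2)] d(2)) auto
    then show ?thesis using y by auto
  qed
  obtain X Y where XY: "\<And>k. a < X k \<and> X k < a + h k \<and> b < Y k \<and> Y k < b + h k \<and>
      \<Delta> k = h k * (h k * \<partial>\<^sub>y (\<partial>\<^sub>x f) (X k, Y k))"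
    using 1 by metis
  obtain X' Y' where XY': "\<And>k. a < X' k \<and> X' k < a + h k \<and> b < Y' k \<and> Y' k < b + h k \<and>
      \<Delta> k = h k * (h k * \<partial>\<^sub>x (\<partial>\<^sub>y f) (X' k, Y' k))"
    using 2 by metis
  have eq: "\<partial>\<^sub>y (\<partial>\<^sub>x f) (X k, Y k) = \<partial>\<^sub>x (\<partial>\<^sub>y f) (X' k, Y' k)" for k
    using XY[of k] XY'[of k] h(1)[of k] by auto
  have sq: "Z \<longlonglongrightarrow> c" if "\<And>k. c < Z k \<and> Z k < c + h k" for Z and c :: real
  proof (rule tendsto_sandwich[of "\<lambda>_. c" _ _ "\<lambda>k. c + h k"])
    show "(\<lambda>k. c + h k) \<longlonglongrightarrow> c" using tendsto_add[OF tendsto_const h0, of c] by simp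
  qed (use that in \<open>auto intro!: always_eventually less_imp_le\<close>)
  have "(\<lambda>k. \<partial>\<^sub>y (\<partial>\<^sub>x f) (X k, Y k)) \<longlonglongrightarrow> \<partial>\<^sub>y (\<partial>\<^sub>x f) (a, b)"
    by (rule lim[OF smooth_on_partial(2)[OF sp(1)]]; rule sq; use XY in blast)
  moreover have "(\<lambda>k. \<partial>\<^sub>x (\<partial>\<^sub>y f) (X' k, Y' k)) \<longlonglongrightarrow> \<partial>\<^sub>x (\<partial>\<^sub>y f) (a, b)"
    by (rule lim[OF smooth_on_partial(1)[OF sp(2)]]; rule sq; use XY' in blast)
  ultimately show ?thesis
    unfolding ab eq by (rule LIMSEQ_unique)
qed

lemma partial_symmetric:
  fixes f :: "real \<times> real \<Rightarrow> real^'n"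
  assumes D: "open D" and f: "smooth_on D f" and p: "p \<in> D"
  shows "\<partial>\<^sub>y (\<partial>\<^sub>x f) p = \<partial>\<^sub>x (\<partial>\<^sub>y f) p"
proof (rule vec_eq_iff[THEN iffD2, rule_format])
  fix i
  note sp = smooth_on_partial[OF f]
  have "\<partial>\<^sub>y (\<partial>\<^sub>x f) p $ i = \<partial>\<^sub>y (\<lambda>q. \<partial>\<^sub>x f q $ i) p"
    by (simp add: partial_nth smooth_on_differentiable[OF sp(1) p])
  also have "\<dots> = \<partial>\<^sub>y (\<partial>\<^sub>x (\<lambda>q. f q $ i)) p"
    by (rule partial_cong[OF D p]) (simp add: partial_nth smooth_on_differentiable[OF f])
  also have "\<dots> = \<partial>\<^sub>x (\<partial>\<^sub>y (\<lambda>q. f q $ i)) p"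
    by (rule partial_symmetric_real[OF D smooth_on_nth[OF D f] p])
  also have "\<dots> = \<partial>\<^sub>x (\<lambda>q. \<partial>\<^sub>y f q $ i) p"
    by (rule partial_cong[OF D p]) (simp add: partial_nth smooth_on_differentiable[OF f])
  also have "\<dots> = \<partial>\<^sub>x (\<partial>\<^sub>y f) p $ i"
    by (simp add: partial_nth smooth_on_differentiable[OF sp(2) p])
  finally show "\<partial>\<^sub>y (\<partial>\<^sub>x f) p $ i = \<partial>\<^sub>x (\<partial>\<^sub>y f) p $ i" .
qed

section \<open>Flat normal bundles in the Lorentzian quadric\<close>

lemma exhaust_5:
  fixes x :: 5
  shows "x = 1 \<or> x = 2 \<or> x = 3 \<or> x = 4 \<or> x = 5"
proof (induct x)
  case (of_int z)
  then have "z = 0 \<or> z = 1 \<or> z = 2 \<or> z = 3 \<or> z = 4" by fastforce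
  then show ?case by auto
qed

lemma forall_5: "(\<forall>i::5. P i) \<longleftrightarrow> P 1 \<and> P 2 \<and> P 3 \<and> P 4 \<and> P 5"
  by (metis exhaust_5)

lemma vector_5 [simp]:
  "(vector [a, b, c, d, e] :: ('a::zero)^5) $ 1 = a"
  "(vector [a, b, c, d, e] :: ('a::zero)^5) $ 2 = b"
  "(vector [a, b, c, d, e] :: ('a::zero)^5) $ 3 = c"
  "(vector [a, b, c, d, e] :: ('a::zero)^5) $ 4 = d"
  "(vector [a, b, c, d, e] :: ('a::zero)^5) $ 5 = e"
  unfolding vector_def by simp_all

lemma vector_6 [simp]:
  "(vector [a, b, c, d, e, f] :: ('a::zero)^6) $ 1 = a"
  "(vector [a, b, c, d, e, f] :: ('a::zero)^6) $ 2 = b"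
  "(vector [a, b, c, d, e, f] :: ('a::zero)^6) $ 3 = c"
  "(vector [a, b, c, d, e, f] :: ('a::zero)^6) $ 4 = d"
  "(vector [a, b, c, d, e, f] :: ('a::zero)^6) $ 5 = e"
  "(vector [a, b, c, d, e, f] :: ('a::zero)^6) $ 6 = f"
  unfolding vector_def by simp_all

lemma bounded_bilinear_lorentz: "bounded_bilinear lorentz"
proof -
  have "bilinear lorentz"
    unfolding bilinear_def
    by (auto intro!: linearI simp: lorentz_def algebra_simps)
  then show ?thesis
    by (simp add: bilinear_conv_bounded_bilinear)
qed

interpretation lorentz: bounded_bilinear lorentz
  by (rule bounded_bilinear_lorentz)

lemmas partial_lorentz = partial_bilinear[OF bounded_bilinear_lorentz]
lemmas smooth_on_lorentz = smooth_on_bilinear[OF _ bounded_bilinear_lorentz]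

lemma lorentz_commute: "lorentz u v = lorentz v u"
  by (simp add: lorentz_def mult.commute)

lemma lorentz_nondegenerate:
  assumes "\<And>v. lorentz u v = 0"
  shows "u = 0"
proof -
  have "u $ i = 0" for i
    using exhaust_5[of i] assms[of "axis i 1"] by (auto simp: lorentz_def axis_def)
  then show ?thesis by (simp add: vec_eq_iff)
qed

text \<open>Makes the definite description computable. Two admissible normal parts differ by a
  tangent vector orthogonal to both coordinate directions; in an orthogonal frame of non-null
  vectors its coefficients vanish.\<close>

lemma normal_component_unique:
  assumes u: "u \<in> normal_space F p" and v: "v - u = a *\<^sub>R \<partial>\<^sub>x F p + b *\<^sub>R \<partial>\<^sub>y F p"
    and orth: "lorentz (\<partial>\<^sub>x F p) (\<partial>\<^sub>y F p) = 0"
    and nz: "lorentz (\<partial>\<^sub>x F p) (\<partial>\<^sub>x F p) \<noteq> 0" "lorentz (\<partial>\<^sub>y F p) (\<partial>\<^sub>y F p) \<noteq> 0"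
  shows "normal_component F p v = u"
  unfolding normal_component_def
proof (rule the_equality)
  show "u \<in> normal_space F p \<and> v - u \<in> span {\<partial>\<^sub>x F p, \<partial>\<^sub>y F p}"
    unfolding v by (intro conjI u span_add span_scale span_base) simp_all
next
  fix w assume w: "w \<in> normal_space F p \<and> v - w \<in> span {\<partial>\<^sub>x F p, \<partial>\<^sub>y F p}"
  then obtain a' b' where "v - w = a' *\<^sub>R \<partial>\<^sub>x F p + b' *\<^sub>R \<partial>\<^sub>y F p"
    by (auto simp: span_insert[of "\<partial>\<^sub>x F p"] span_singleton algebra_simps)
  then have d: "w - u = (a - a') *\<^sub>R \<partial>\<^sub>x F p + (b - b') *\<^sub>R \<partial>\<^sub>y F p"
    using v by (simp add: algebra_simps)
  have "lorentz (w - u) (\<partial>\<^sub>x F p) = 0" "lorentz (w - u) (\<partial>\<^sub>y F p) = 0"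
    using u w by (simp_all add: normal_space_def lorentz.diff_left)
  then have "a - a' = 0" "b - b' = 0"
    using nz orth lorentz_commute[of "\<partial>\<^sub>y F p" "\<partial>\<^sub>x F p"]
    unfolding d by (simp_all add: lorentz.add_left lorentz.scaleR_left)
  then show "w = u" using d by simp
qed

text \<open>\<open>conj\<close> is the classical conjugacy of the coordinate net: it says that the
  second fundamental form has no mixed coefficient in any normal direction.\<close>

locale orthogonal_net =
  fixes D :: "(real \<times> real) set" and F :: "real \<times> real \<Rightarrow> real^5"
  assumes D: "open D" and F: "nondegenerate_surface D F"
    and orth: "\<And>p. p \<in> D \<Longrightarrow> lorentz (\<partial>\<^sub>x F p) (\<partial>\<^sub>y F p) = 0"
    and conj: "\<And>p w. p \<in> D \<Longrightarrow> w \<in> normal_space F p \<Longrightarrow> lorentz w (\<partial>\<^sub>y (\<partial>\<^sub>x F) p) = 0"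
begin

text \<open>By \<open>orth\<close> the Gram determinant in the nondegeneracy condition is the
  product of its diagonal entries, so neither coordinate direction is null.\<close>

lemma smooth: "smooth_on D F"
  and unit: "p \<in> D \<Longrightarrow> lorentz (F p) (F p) = 1"
  and nz: "p \<in> D \<Longrightarrow> lorentz (\<partial>\<^sub>x F p) (\<partial>\<^sub>x F p) \<noteq> 0" "p \<in> D \<Longrightarrow> lorentz (\<partial>\<^sub>y F p) (\<partial>\<^sub>y F p) \<noteq> 0"
  using F orth by (auto simp: nondegenerate_surface_def S31_def image_subset_iff)

lemmas smooth_partial = smooth_on_partial[OF smooth]

lemma lorentz_partial_swap:
  assumes "smooth_on D f" "smooth_on D g" "p \<in> D" "\<And>q. q \<in> D \<Longrightarrow> lorentz (f q) (g q) = c"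
  shows "lorentz (\<partial>\<^sub>x f p) (g p) = - lorentz (f p) (\<partial>\<^sub>x g p)"
    "lorentz (\<partial>\<^sub>y f p) (g p) = - lorentz (f p) (\<partial>\<^sub>y g p)"
proof -
  have "\<partial>\<^sub>x (\<lambda>q. lorentz (f q) (g q)) p = 0" "\<partial>\<^sub>y (\<lambda>q. lorentz (f q) (g q)) p = 0"
    using partial_cong[OF D assms(3), of "\<lambda>q. lorentz (f q) (g q)" "\<lambda>q. c"] assms(4) by auto
  then show "lorentz (\<partial>\<^sub>x f p) (g p) = - lorentz (f p) (\<partial>\<^sub>x g p)"
    "lorentz (\<partial>\<^sub>y f p) (g p) = - lorentz (f p) (\<partial>\<^sub>y g p)"
    using assms by (simp_all add: partial_lorentz smooth_on_differentiable)
qed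

lemma F_partial:
  assumes "p \<in> D"
  shows "lorentz (F p) (\<partial>\<^sub>x F p) = 0" "lorentz (F p) (\<partial>\<^sub>y F p) = 0"
  using lorentz_partial_swap[OF smooth smooth assms, of 1] unit
    lorentz_commute[of "F p"] by (metis neg_equal_zero)+

text \<open>For a normal field this is, up to sign, the principal curvature in that normal direction
  along x (the coefficient in the Weingarten formula).\<close>

definition shape_x where
  "shape_x \<xi> p = lorentz (\<partial>\<^sub>x \<xi> p) (\<partial>\<^sub>x F p) / lorentz (\<partial>\<^sub>x F p) (\<partial>\<^sub>x F p)"
definition shape_y where
  "shape_y \<xi> p = lorentz (\<partial>\<^sub>y \<xi> p) (\<partial>\<^sub>y F p) / lorentz (\<partial>\<^sub>y F p) (\<partial>\<^sub>y F p)"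

lemma smooth_shape:
  assumes "smooth_on D \<xi>"
  shows "smooth_on D (shape_x \<xi>)" "smooth_on D (shape_y \<xi>)"
  unfolding shape_x_def[abs_def] shape_y_def[abs_def]
  by (intro smooth_on_divide smooth_on_lorentz D smooth_on_partial assms smooth nz; assumption)+

text \<open>The Weingarten formula in curvature line coordinates. Differentiating the normality
  relations in x gives a derivative of \<open>\<xi>\<close> orthogonal to \<open>F\<close>, and
  orthogonal to the y-direction by \<open>conj\<close>; only a component along the x-direction has
  to be removed. The y-derivative is treated in the same way.\<close>

lemma normal_connection:
  assumes \<xi>: "smooth_on D \<xi>" "\<And>q. q \<in> D \<Longrightarrow> \<xi> q \<in> normal_space F q" and p: "p \<in> D"
  shows "normal_connection_x F \<xi> p = \<partial>\<^sub>x \<xi> p - shape_x \<xi> p *\<^sub>R \<partial>\<^sub>x F p"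
    and "\<partial>\<^sub>x \<xi> p - shape_x \<xi> p *\<^sub>R \<partial>\<^sub>x F p \<in> normal_space F p"
    and "normal_connection_y F \<xi> p = \<partial>\<^sub>y \<xi> p - shape_y \<xi> p *\<^sub>R \<partial>\<^sub>y F p"
    and "\<partial>\<^sub>y \<xi> p - shape_y \<xi> p *\<^sub>R \<partial>\<^sub>y F p \<in> normal_space F p"
proof -
  have n: "lorentz (\<xi> q) (F q) = 0" "lorentz (\<xi> q) (\<partial>\<^sub>x F q) = 0" "lorentz (\<xi> q) (\<partial>\<^sub>y F q) = 0"
    if "q \<in> D" for q
    using \<xi>(2)[OF that] by (auto simp: normal_space_def)
  have t: "lorentz (\<partial>\<^sub>x \<xi> p) (F p) = 0" "lorentz (\<partial>\<^sub>y \<xi> p) (F p) = 0"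
    using lorentz_partial_swap[OF \<xi>(1) smooth p, of 0] n p by auto
  have xy: "lorentz (\<partial>\<^sub>x \<xi> p) (\<partial>\<^sub>y F p) = 0"
    using lorentz_partial_swap(1)[OF \<xi>(1) smooth_partial(2) p, of 0] n conj[OF p \<xi>(2)[OF p]]
      partial_symmetric[OF D smooth p] by auto
  have yx: "lorentz (\<partial>\<^sub>y \<xi> p) (\<partial>\<^sub>x F p) = 0"
    using lorentz_partial_swap(2)[OF \<xi>(1) smooth_partial(1) p, of 0] n conj[OF p \<xi>(2)[OF p]] by auto
  note o = orth[OF p] lorentz_commute[of "\<partial>\<^sub>y F p" "\<partial>\<^sub>x F p"]
  show nx: "\<partial>\<^sub>x \<xi> p - shape_x \<xi> p *\<^sub>R \<partial>\<^sub>x F p \<in> normal_space F p"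
    using nz[OF p] t xy o F_partial[OF p] lorentz_commute[of "\<partial>\<^sub>x F p" "F p"]
    by (simp add: normal_space_def lorentz.diff_left lorentz.scaleR_left shape_x_def)
  show ny: "\<partial>\<^sub>y \<xi> p - shape_y \<xi> p *\<^sub>R \<partial>\<^sub>y F p \<in> normal_space F p"
    using nz[OF p] t yx o F_partial[OF p] lorentz_commute[of "\<partial>\<^sub>y F p" "F p"]
    by (simp add: normal_space_def lorentz.diff_left lorentz.scaleR_left shape_y_def)
  show "normal_connection_x F \<xi> p = \<partial>\<^sub>x \<xi> p - shape_x \<xi> p *\<^sub>R \<partial>\<^sub>x F p"
    unfolding normal_connection_x_def
    by (rule normal_component_unique[OF nx _ orth[OF p] nz[OF p], of _ "shape_x \<xi> p" 0])
      (simp add: S31_tangent_part_def t)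
  show "normal_connection_y F \<xi> p = \<partial>\<^sub>y \<xi> p - shape_y \<xi> p *\<^sub>R \<partial>\<^sub>y F p"
    unfolding normal_connection_y_def
    by (rule normal_component_unique[OF ny _ orth[OF p] nz[OF p], of _ 0 "shape_y \<xi> p"])
      (simp add: S31_tangent_part_def t)
qed

text \<open>The Lorentz form is nondegenerate on the normal space: \<open>F\<close> and its two
  partials are mutually orthogonal and non-null, so every \<open>v\<close> can be corrected to a
  normal vector without changing its product with \<open>\<delta>\<close>.\<close>

lemma normal_vector_eq_0:
  assumes p: "p \<in> D" and \<delta>: "\<delta> \<in> normal_space F p"
    and w: "\<And>w. w \<in> normal_space F p \<Longrightarrow> lorentz w \<delta> = 0"
  shows "\<delta> = 0"
proof (rule lorentz_nondegenerate)
  fix v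
  note o = orth[OF p] lorentz_commute[of "\<partial>\<^sub>y F p" "\<partial>\<^sub>x F p"] F_partial[OF p]
    lorentz_commute[of "\<partial>\<^sub>x F p" "F p"] lorentz_commute[of "\<partial>\<^sub>y F p" "F p"]
  define c where "c = lorentz v (F p)"
  define a where "a = lorentz v (\<partial>\<^sub>x F p) / lorentz (\<partial>\<^sub>x F p) (\<partial>\<^sub>x F p)"
  define b where "b = lorentz v (\<partial>\<^sub>y F p) / lorentz (\<partial>\<^sub>y F p) (\<partial>\<^sub>y F p)"
  have "v - c *\<^sub>R F p - a *\<^sub>R \<partial>\<^sub>x F p - b *\<^sub>R \<partial>\<^sub>y F p \<in> normal_space F p"
    using nz[OF p] o unit[OF p]
    by (simp add: normal_space_def lorentz.diff_left lorentz.scaleR_left a_def b_def c_def)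
  from w[OF this] show "lorentz \<delta> v = 0"
    using \<delta> lorentz_commute[of \<delta>]
    by (simp add: normal_space_def lorentz.diff_left lorentz.scaleR_left)
qed

text \<open>The curvature vector is normal, so it suffices to pair it with normal vectors. The mixed
  derivatives of \<open>\<xi>\<close> cancel by symmetry, the mixed derivative of \<open>F\<close>
  drops out by \<open>conj\<close>, and all remaining terms are tangent.\<close>

lemma flat: "flat_normal_bundle D F"
  unfolding flat_normal_bundle_def
proof (intro allI impI ballI, elim conjE)
  fix \<xi> p assume \<xi>: "smooth_on D \<xi>" "\<forall>p\<in>D. \<xi> p \<in> normal_space F p" and p: "p \<in> D"
  let ?x = "\<lambda>q. \<partial>\<^sub>x \<xi> q - shape_x \<xi> q *\<^sub>R \<partial>\<^sub>x F q" and ?y = "\<lambda>q. \<partial>\<^sub>y \<xi> q - shape_y \<xi> q *\<^sub>R \<partial>\<^sub>y F q"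
  note c = normal_connection[OF \<xi>(1) bspec[OF \<xi>(2)]]
  have sx: "smooth_on D ?x" and sy: "smooth_on D ?y"
    by (intro smooth_intros D smooth_shape \<xi>(1) smooth)+
  \<comment> \<open>The covariant derivative agrees with \<open>?y\<close> on \<open>D\<close> and
    is again a smooth normal field there, so the Weingarten formula can be applied a second
    time.\<close>
  have x: "normal_connection_x F (normal_connection_y F \<xi>) p = \<partial>\<^sub>x ?y p - shape_x ?y p *\<^sub>R \<partial>\<^sub>x F p"
    and nx: "\<partial>\<^sub>x ?y p - shape_x ?y p *\<^sub>R \<partial>\<^sub>x F p \<in> normal_space F p"
    using normal_connection(1,2)[OF sy c(4) p] partial_cong(1)[OF D p c(3)]
    by (simp_all add: normal_connection_x_def)
  have y: "normal_connection_y F (normal_connection_x F \<xi>) p = \<partial>\<^sub>y ?x p - shape_y ?x p *\<^sub>R \<partial>\<^sub>y F p"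
    and ny: "\<partial>\<^sub>y ?x p - shape_y ?x p *\<^sub>R \<partial>\<^sub>y F p \<in> normal_space F p"
    using normal_connection(3,4)[OF sx c(2) p] partial_cong(2)[OF D p c(1)]
    by (simp_all add: normal_connection_y_def)
  note d = smooth_on_differentiable[OF _ p]
  have ex: "\<partial>\<^sub>x ?y p = \<partial>\<^sub>x (\<partial>\<^sub>y \<xi>) p - (shape_y \<xi> p *\<^sub>R \<partial>\<^sub>x (\<partial>\<^sub>y F) p + \<partial>\<^sub>x (shape_y \<xi>) p *\<^sub>R \<partial>\<^sub>y F p)"
    by (subst partial_diff partial_scaleR;
        (intro d smooth_intros D smooth_shape \<xi>(1) smooth | simp add: partial_scaleR d smooth_shape \<xi>(1) smooth_partial))
  have ey: "\<partial>\<^sub>y ?x p = \<partial>\<^sub>y (\<partial>\<^sub>x \<xi>) p - (shape_x \<xi> p *\<^sub>R \<partial>\<^sub>y (\<partial>\<^sub>x F) p + \<partial>\<^sub>y (shape_x \<xi>) p *\<^sub>R \<partial>\<^sub>x F p)"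
    by (subst partial_diff partial_scaleR;
        (intro d smooth_intros D smooth_shape \<xi>(1) smooth | simp add: partial_scaleR d smooth_shape \<xi>(1) smooth_partial))
  have "normal_curvature F \<xi> p \<in> normal_space F p"
    using nx ny unfolding normal_curvature_def x y
    by (simp add: normal_space_def lorentz.diff_left)
  moreover have "lorentz w (normal_curvature F \<xi> p) = 0" if w: "w \<in> normal_space F p" for w
  proof -
    have "lorentz w (\<partial>\<^sub>x F p) = 0" "lorentz w (\<partial>\<^sub>y F p) = 0"
      using w by (simp_all add: normal_space_def)
    then show ?thesis
      using conj[OF p w] partial_symmetric[OF D smooth p] partial_symmetric[OF D \<xi>(1) p]
      unfolding normal_curvature_def x y ex ey
      by (simp add: lorentz.diff_right lorentz.add_right lorentz.scaleR_right)
  qed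
  ultimately show "normal_curvature F \<xi> p = 0"
    using normal_vector_eq_0[OF p] by blast
qed

end

section \<open>Ribaucour congruences\<close>

lemma differentiable_inner [simp]:
  assumes "f differentiable (at p)" "g differentiable (at p)"
  shows "(\<lambda>q. f q \<bullet> g q) differentiable (at p)"
  using differentiable_bilinear[OF bounded_bilinear_inner assms] .

lemma cross3_parallel_normal:
  fixes N :: "real^3"
  assumes "norm N = 1" "N \<bullet> a = 0" "N \<bullet> b = 0"
  shows "cross3 a b = (N \<bullet> cross3 a b) *\<^sub>R N"
proof -
  have "cross3 N (cross3 a b) = 0"
    using assms by (simp add: Lagrange)
  then have "cross3 N (cross3 N (cross3 a b)) = 0"
    by simp
  then have "(N \<bullet> cross3 a b) *\<^sub>R N - (N \<bullet> N) *\<^sub>R cross3 a b = 0"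
    by (simp only: Lagrange[of N N])
  then show ?thesis
    using assms(1) by (simp add: norm_eq_1)
qed

text \<open>Otherwise the normalized \<open>e\<close> and \<open>c\<close> would be two orthogonal
  unit normals of \<open>a\<close> and \<open>b\<close>. The cross product of \<open>a\<close> and
  \<open>b\<close> is a multiple of each, hence zero, which is impossible for orthogonal nonzero
  vectors.\<close>

lemma orthogonal_to_frame_eq_0:
  fixes a b c e :: "real^3"
  assumes "a \<noteq> 0" "b \<noteq> 0" "norm c = 1" "a \<bullet> b = 0" "c \<bullet> a = 0" "c \<bullet> b = 0"
    and "e \<bullet> a = 0" "e \<bullet> b = 0" "e \<bullet> c = 0"
  shows "e = 0"
proof (rule ccontr)
  assume "e \<noteq> 0"
  define f where "f = sgn e"
  have f: "norm f = 1" "f \<bullet> a = 0" "f \<bullet> b = 0" "f \<bullet> c = 0"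
    using \<open>e \<noteq> 0\<close> assms by (simp_all add: f_def norm_sgn sgn_div_norm)
  define w where "w = cross3 a b"
  have "w = (f \<bullet> w) *\<^sub>R f" "w = (c \<bullet> w) *\<^sub>R c"
    unfolding w_def using cross3_parallel_normal f assms by blast+
  then have "f \<bullet> w = f \<bullet> ((c \<bullet> w) *\<^sub>R c)"
    by simp
  then have "w = 0"
    using \<open>w = (f \<bullet> w) *\<^sub>R f\<close> f(4) by simp
  then show False
    using norm_cross_dot[of a b] assms by (simp add: w_def)
qed

text \<open>Differentiating \<open>N . X_y = 0\<close> in x trades the second derivative of
  \<open>X\<close> for a first derivative of the normal.\<close>

lemma curvature_coordinates_atI:
  assumes D: "open D" and X: "smooth_on D X" and N: "unit_normal_on D X N" and p: "p \<in> D"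
    and o: "\<partial>\<^sub>x X p \<bullet> \<partial>\<^sub>y X p = 0" "\<partial>\<^sub>y X p \<bullet> \<partial>\<^sub>x N p = 0" and i: "immersed_at X p"
  shows "curvature_coordinates_at X p"
proof -
  have n: "smooth_on D N" "norm (N q) = 1" "N q \<bullet> \<partial>\<^sub>x X q = 0" "N q \<bullet> \<partial>\<^sub>y X q = 0" if "q \<in> D" for q
    using N that by (auto simp: unit_normal_on_def)
  have "\<partial>\<^sub>x (\<lambda>q. N q \<bullet> \<partial>\<^sub>y X q) p = 0"
    using partial_cong(1)[OF D p, of "\<lambda>q. N q \<bullet> \<partial>\<^sub>y X q" "\<lambda>q. 0"] n by auto
  then have "N p \<bullet> \<partial>\<^sub>x (\<partial>\<^sub>y X) p = 0"
    using o(2) n(1)[OF p] smooth_on_partial(2)[OF X] p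
    by (simp add: partial_inner smooth_on_differentiable inner_commute)
  \<comment> \<open>The orientation of \<open>N\<close> is irrelevant to a vanishing condition, so
    proportionality to the Gauss normal is enough.\<close>
  moreover obtain t where "gauss_normal X p = t *\<^sub>R N p"
    unfolding gauss_normal_def sgn_div_norm
    using cross3_parallel_normal[OF n(2-4)[OF p]] by (metis scaleR_scaleR)
  ultimately show ?thesis
    using o i by (simp add: curvature_coordinates_at_def inner_commute)
qed

text \<open>Reflection in the plane orthogonal to \<open>m\<close>. For \<open>m = 0\<close>
  division by zero yields the identity, so it is an isometry for every \<open>m\<close>.\<close>

definition reflect :: "real^3 \<Rightarrow> real^3 \<Rightarrow> real^3" where
  "reflect m a = a - (2 * (a \<bullet> m) / (m \<bullet> m)) *\<^sub>R m"

lemma inner_reflect: "reflect m a \<bullet> reflect m b = a \<bullet> b"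
proof (cases "m = 0")
  case False
  define \<alpha> where "\<alpha> = 2 * (a \<bullet> m) / (m \<bullet> m)"
  define \<beta> where "\<beta> = 2 * (b \<bullet> m) / (m \<bullet> m)"
  have "\<alpha> * (m \<bullet> m) = 2 * (a \<bullet> m)" "\<alpha> * (b \<bullet> m) = \<beta> * (a \<bullet> m)"
    using False by (simp_all add: \<alpha>_def \<beta>_def)
  moreover have "reflect m a \<bullet> reflect m b =
      a \<bullet> b - \<beta> * (a \<bullet> m) - \<alpha> * (b \<bullet> m) + \<beta> * (\<alpha> * (m \<bullet> m))"
    unfolding reflect_def \<alpha>_def[symmetric] \<beta>_def[symmetric] inner_diff_left inner_diff_right
      inner_scaleR_left inner_scaleR_right inner_commute[of m b] by (simp add: algebra_simps)
  ultimately show ?thesis by simp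
qed (simp add: reflect_def)

text \<open>The hypotheses in vector form: \<open>k\<close> is the axis orthogonal to the plane of
  the \<open>U\<close>'s, \<open>m1\<close> and \<open>m2\<close> are the analogues of
  \<open>l1\<close> and \<open>l2\<close> for the third solution. The relations with
  \<open>k\<close> are imposed at all points, so that identities such as \<open>n . n = 1\<close>
  are equalities of functions and can be differentiated.\<close>

locale ribaucour_net =
  fixes D :: "(real \<times> real) set" and U1 U2 U3 :: "real \<times> real \<Rightarrow> real^3" and k :: "real^3"
    and A V31 V32 l1 l2 m1 m2 :: "real \<times> real \<Rightarrow> real"
  assumes D: "open D"
    and smooth_U: "smooth_on D U1" "smooth_on D U2" "smooth_on D U3"
    and smooth_V: "smooth_on D A" "smooth_on D V31" "smooth_on D V32"
    and smooth_l: "smooth_on D l1" "smooth_on D l2"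
    and k: "k \<bullet> k = 1" "\<And>p. U1 p \<bullet> k = 0" "\<And>p. U2 p \<bullet> k = 0" "\<And>p. U3 p \<bullet> k = 0"
    and U2: "\<And>p. p \<in> D \<Longrightarrow> \<partial>\<^sub>x U2 p = l1 p *\<^sub>R \<partial>\<^sub>x U1 p" "\<And>p. p \<in> D \<Longrightarrow> \<partial>\<^sub>y U2 p = l2 p *\<^sub>R \<partial>\<^sub>y U1 p"
    and U3: "\<And>p. p \<in> D \<Longrightarrow> \<partial>\<^sub>x U3 p = m1 p *\<^sub>R \<partial>\<^sub>x U1 p" "\<And>p. p \<in> D \<Longrightarrow> \<partial>\<^sub>y U3 p = m2 p *\<^sub>R \<partial>\<^sub>y U1 p"
    and U1_orth: "\<And>p. p \<in> D \<Longrightarrow> \<partial>\<^sub>x U1 p \<bullet> \<partial>\<^sub>y U1 p = 0"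
    and U1_nz: "\<And>p. p \<in> D \<Longrightarrow> \<partial>\<^sub>x U1 p \<noteq> 0" "\<And>p. p \<in> D \<Longrightarrow> \<partial>\<^sub>y U1 p \<noteq> 0"
    and A: "\<And>p. p \<in> D \<Longrightarrow> \<partial>\<^sub>x A p = U1 p \<bullet> \<partial>\<^sub>x U2 p" "\<And>p. p \<in> D \<Longrightarrow> \<partial>\<^sub>y A p = U1 p \<bullet> \<partial>\<^sub>y U2 p"
    and V31: "\<And>p. p \<in> D \<Longrightarrow> \<partial>\<^sub>x V31 p = U3 p \<bullet> \<partial>\<^sub>x U1 p" "\<And>p. p \<in> D \<Longrightarrow> \<partial>\<^sub>y V31 p = U3 p \<bullet> \<partial>\<^sub>y U1 p"
    and V32: "\<And>p. p \<in> D \<Longrightarrow> \<partial>\<^sub>x V32 p = U3 p \<bullet> \<partial>\<^sub>x U2 p" "\<And>p. p \<in> D \<Longrightarrow> \<partial>\<^sub>y V32 p = U3 p \<bullet> \<partial>\<^sub>y U2 p"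
    and V31_nz: "\<And>p. p \<in> D \<Longrightarrow> V31 p \<noteq> 0"
begin

definition "B p = (U1 p \<bullet> U1 p + 1) / 2"
text \<open>As \<open>U1 + k\<close> has squared length \<open>2 B\<close>, this is its inversion in
  the sphere of radius sqrt 2 about the origin; hence \<open>n = N - k\<close> is the inverse
  stereographic projection of \<open>U1\<close> from the pole \<open>-k\<close>.\<close>

definition "N p = inverse (B p) *\<^sub>R (U1 p + k)"
definition "n p = N p - k"
definition "r p = U2 p - A p *\<^sub>R N p"
definition "M p = U3 p - (U1 p \<bullet> U3 p - V31 p) *\<^sub>R N p"
definition "v p = V32 p / V31 p"
definition "R p = v p * B p - A p"
definition "P p = V32 p - V31 p * A p / B p"
definition "Q p = V31 p / B p"
definition "c p = r p - R p *\<^sub>R n p"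
definition "\<rho>1 p = l1 p * B p - A p"
definition "\<rho>2 p = l2 p * B p - A p"

lemma B_pos: "B p > 0"
  unfolding B_def by (simp add: add_nonneg_pos)

lemma B_nz [simp]: "B p \<noteq> 0"
  using B_pos[of p] by simp

lemma smooth_B: "smooth_on D B"
  unfolding B_def[abs_def] by (intro smooth_intros D smooth_U) simp

lemma smooth_N: "smooth_on D N"
  unfolding N_def[abs_def] by (intro smooth_intros smooth_on_inverse D smooth_U smooth_B B_nz)

lemma smooth_n: "smooth_on D n"
  unfolding n_def[abs_def] by (intro smooth_intros D smooth_N)

lemma smooth_r: "smooth_on D r"
  unfolding r_def[abs_def] by (intro smooth_intros D smooth_N smooth_U smooth_V)

lemma smooth_M: "smooth_on D M"
  unfolding M_def[abs_def] by (intro smooth_intros D smooth_N smooth_U smooth_V)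

lemma smooth_v: "smooth_on D v"
  unfolding v_def[abs_def] by (intro smooth_intros D smooth_V V31_nz)

lemma smooth_R: "smooth_on D R"
  unfolding R_def[abs_def] by (intro smooth_intros D smooth_V smooth_v smooth_B)

lemma smooth_P: "smooth_on D P"
  unfolding P_def[abs_def] by (intro smooth_intros D smooth_V smooth_B B_nz)

lemma smooth_Q: "smooth_on D Q"
  unfolding Q_def[abs_def] by (intro smooth_intros D smooth_V smooth_B B_nz)

lemma smooth_c: "smooth_on D c"
  unfolding c_def[abs_def] by (intro smooth_intros D smooth_r smooth_R smooth_n)

lemmas smooth_all = smooth_U smooth_V smooth_l smooth_B smooth_N smooth_n smooth_r smooth_M
  smooth_v smooth_R smooth_P smooth_Q smooth_c

lemmas diff = smooth_all[THEN smooth_on_differentiable]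

lemma partial_B:
  assumes "p \<in> D"
  shows "\<partial>\<^sub>x B p = U1 p \<bullet> \<partial>\<^sub>x U1 p" "\<partial>\<^sub>y B p = U1 p \<bullet> \<partial>\<^sub>y U1 p"
  unfolding B_def[abs_def] using assms
  by (simp_all add: partial_divide partial_add partial_inner diff inner_commute)

lemma partial_n:
  assumes "p \<in> D"
  shows "\<partial>\<^sub>x n p = inverse (B p) *\<^sub>R (\<partial>\<^sub>x U1 p - \<partial>\<^sub>x B p *\<^sub>R N p)"
    "\<partial>\<^sub>y n p = inverse (B p) *\<^sub>R (\<partial>\<^sub>y U1 p - \<partial>\<^sub>y B p *\<^sub>R N p)"
  using assms
  by (simp_all add: n_def[abs_def] N_def[abs_def] partial_diff partial_add partial_scaleR
      partial_inverse diff algebra_simps)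

lemma partial_N:
  assumes "p \<in> D"
  shows "\<partial>\<^sub>x N p = \<partial>\<^sub>x n p" "\<partial>\<^sub>y N p = \<partial>\<^sub>y n p"
  using assms by (simp_all add: n_def[abs_def] partial_diff diff)

text \<open>Surfaces of this form share the Gauss map \<open>n\<close> and its lines of curvature.\<close>

lemma partial_combescure:
  assumes U: "smooth_on D U" and a: "smooth_on D a" and p: "p \<in> D"
  shows "\<partial>\<^sub>x U p = l *\<^sub>R \<partial>\<^sub>x U1 p \<Longrightarrow> \<partial>\<^sub>x a p = U1 p \<bullet> \<partial>\<^sub>x U p \<Longrightarrow>
      \<partial>\<^sub>x (\<lambda>q. U q - a q *\<^sub>R N q) p = (l * B p - a p) *\<^sub>R \<partial>\<^sub>x n p"
    "\<partial>\<^sub>y U p = l *\<^sub>R \<partial>\<^sub>y U1 p \<Longrightarrow> \<partial>\<^sub>y a p = U1 p \<bullet> \<partial>\<^sub>y U p \<Longrightarrow>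
      \<partial>\<^sub>y (\<lambda>q. U q - a q *\<^sub>R N q) p = (l * B p - a p) *\<^sub>R \<partial>\<^sub>y n p"
proof -
  \<comment> \<open>Since \<open>a_x = l B_x\<close>, the term \<open>- a_x N\<close> of the product
    rule combines with \<open>l U1_x\<close> to \<open>l B n_x\<close>; the remaining term is
    \<open>- a n_x\<close>.\<close>
  have B: "B p *\<^sub>R \<partial>\<^sub>x n p = \<partial>\<^sub>x U1 p - \<partial>\<^sub>x B p *\<^sub>R N p" "B p *\<^sub>R \<partial>\<^sub>y n p = \<partial>\<^sub>y U1 p - \<partial>\<^sub>y B p *\<^sub>R N p"
    using partial_n[OF p] by simp_all
  note d = smooth_on_differentiable[OF U p] smooth_on_differentiable[OF a p] diff[OF p]
  show "\<partial>\<^sub>x (\<lambda>q. U q - a q *\<^sub>R N q) p = (l * B p - a p) *\<^sub>R \<partial>\<^sub>x n p"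
    if "\<partial>\<^sub>x U p = l *\<^sub>R \<partial>\<^sub>x U1 p" "\<partial>\<^sub>x a p = U1 p \<bullet> \<partial>\<^sub>x U p"
    using that unfolding scaleR_diff_left scaleR_scaleR[symmetric] B
    by (simp add: d partial_diff partial_scaleR partial_N[OF p] partial_B[OF p] algebra_simps)
  show "\<partial>\<^sub>y (\<lambda>q. U q - a q *\<^sub>R N q) p = (l * B p - a p) *\<^sub>R \<partial>\<^sub>y n p"
    if "\<partial>\<^sub>y U p = l *\<^sub>R \<partial>\<^sub>y U1 p" "\<partial>\<^sub>y a p = U1 p \<bullet> \<partial>\<^sub>y U p"
    using that unfolding scaleR_diff_left scaleR_scaleR[symmetric] B
    by (simp add: d partial_diff partial_scaleR partial_N[OF p] partial_B[OF p] algebra_simps)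
qed

lemma partial_r:
  assumes "p \<in> D"
  shows "\<partial>\<^sub>x r p = \<rho>1 p *\<^sub>R \<partial>\<^sub>x n p" "\<partial>\<^sub>y r p = \<rho>2 p *\<^sub>R \<partial>\<^sub>y n p"
  unfolding r_def[abs_def] \<rho>1_def \<rho>2_def
  by (intro partial_combescure smooth_U smooth_V assms U2 A)+

definition "\<mu>1 p = m1 p * B p - (U1 p \<bullet> U3 p - V31 p)"
definition "\<mu>2 p = m2 p * B p - (U1 p \<bullet> U3 p - V31 p)"

lemma partial_M:
  assumes "p \<in> D"
  shows "\<partial>\<^sub>x M p = \<mu>1 p *\<^sub>R \<partial>\<^sub>x n p" "\<partial>\<^sub>y M p = \<mu>2 p *\<^sub>R \<partial>\<^sub>y n p"
proof -
  have a: "smooth_on D (\<lambda>p. U1 p \<bullet> U3 p - V31 p)"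
    by (intro smooth_intros D smooth_all)
  have e: "\<partial>\<^sub>x (\<lambda>p. U1 p \<bullet> U3 p - V31 p) p = U1 p \<bullet> \<partial>\<^sub>x U3 p"
    "\<partial>\<^sub>y (\<lambda>p. U1 p \<bullet> U3 p - V31 p) p = U1 p \<bullet> \<partial>\<^sub>y U3 p"
    using assms by (simp_all add: partial_diff partial_inner diff V31 inner_commute)
  show "\<partial>\<^sub>x M p = \<mu>1 p *\<^sub>R \<partial>\<^sub>x n p" "\<partial>\<^sub>y M p = \<mu>2 p *\<^sub>R \<partial>\<^sub>y n p"
    unfolding M_def[abs_def] \<mu>1_def \<mu>2_def
    by (intro partial_combescure smooth_U a assms U3 e)+
qed

section \<open>Metric properties of the Gauss map\<close>

lemma inner_U1_U1: "U1 p \<bullet> U1 p = 2 * B p - 1"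
  by (simp add: B_def field_simps)

lemma N_N: "N p \<bullet> N p = 2 / B p"
  using k by (simp add: N_def inner_add_left inner_add_right inner_commute[of k "U1 p"] inner_U1_U1 field_simps)

lemma N_k: "N p \<bullet> k = 1 / B p"
  using k by (simp add: N_def inner_add_left field_simps)

lemma n_n: "n p \<bullet> n p = 1"
  using N_N[of p] N_k[of p] k(1)
  by (simp add: n_def inner_diff_left inner_diff_right inner_commute[of k "N p"])

lemma norm_n: "norm (n p) = 1"
  using n_n norm_eq_1 by blast

lemma n_partial_n:
  assumes "p \<in> D"
  shows "n p \<bullet> \<partial>\<^sub>x n p = 0" "n p \<bullet> \<partial>\<^sub>y n p = 0"
proof -
  have "\<partial>\<^sub>x (\<lambda>q. n q \<bullet> n q) p = 0" "\<partial>\<^sub>y (\<lambda>q. n q \<bullet> n q) p = 0"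
    by (simp_all add: n_n)
  then show "n p \<bullet> \<partial>\<^sub>x n p = 0" "n p \<bullet> \<partial>\<^sub>y n p = 0"
    using assms by (simp_all add: partial_inner diff inner_commute)
qed

lemma partial_k:
  assumes "p \<in> D"
  shows "\<partial>\<^sub>x U1 p \<bullet> k = 0" "\<partial>\<^sub>y U1 p \<bullet> k = 0"
proof -
  have "\<partial>\<^sub>x (\<lambda>q. U1 q \<bullet> k) p = 0" "\<partial>\<^sub>y (\<lambda>q. U1 q \<bullet> k) p = 0"
    by (simp_all add: k)
  then show "\<partial>\<^sub>x U1 p \<bullet> k = 0" "\<partial>\<^sub>y U1 p \<bullet> k = 0"
    using assms by (simp_all add: partial_inner diff)
qed

text \<open>Stereographic projection is conformal, here with factor \<open>1 / B\<close>. In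
  \<open>g\<close> the corrections along \<open>N\<close> cancel because
  \<open>N . N = 2 / B\<close>, while each cross term contributes \<open>- s t / B\<close>.\<close>

lemma partial_n_inner:
  assumes p: "p \<in> D"
  shows "\<partial>\<^sub>x n p \<bullet> \<partial>\<^sub>y n p = 0"
    and "\<partial>\<^sub>x n p \<bullet> \<partial>\<^sub>x n p = (\<partial>\<^sub>x U1 p \<bullet> \<partial>\<^sub>x U1 p) / (B p * B p)"
    and "\<partial>\<^sub>y n p \<bullet> \<partial>\<^sub>y n p = (\<partial>\<^sub>y U1 p \<bullet> \<partial>\<^sub>y U1 p) / (B p * B p)"
proof -
  have U: "\<partial>\<^sub>x U1 p \<bullet> N p = \<partial>\<^sub>x B p / B p" "\<partial>\<^sub>y U1 p \<bullet> N p = \<partial>\<^sub>y B p / B p"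
    using partial_k[OF p] partial_B[OF p]
    by (simp_all add: N_def inner_add_right divide_inverse inner_commute)
  have g: "(inverse (B p) *\<^sub>R (a - s *\<^sub>R N p)) \<bullet> (inverse (B p) *\<^sub>R (b - t *\<^sub>R N p)) = a \<bullet> b / (B p * B p)"
    if "a \<bullet> N p = s / B p" "b \<bullet> N p = t / B p" for a b s t
    using that N_N[of p]
    by (simp add: inner_diff_left inner_diff_right inner_commute[of "N p" a] inner_commute[of "N p" b] field_simps)
  show "\<partial>\<^sub>x n p \<bullet> \<partial>\<^sub>y n p = 0"
    and "\<partial>\<^sub>x n p \<bullet> \<partial>\<^sub>x n p = (\<partial>\<^sub>x U1 p \<bullet> \<partial>\<^sub>x U1 p) / (B p * B p)"
    and "\<partial>\<^sub>y n p \<bullet> \<partial>\<^sub>y n p = (\<partial>\<^sub>y U1 p \<bullet> \<partial>\<^sub>y U1 p) / (B p * B p)"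
    unfolding partial_n[OF p] g[OF U] g[OF U(1) U(1)] g[OF U(2) U(2)] by (simp_all add: U1_orth p)
qed

lemma partial_n_nz:
  assumes p: "p \<in> D"
  shows "\<partial>\<^sub>x n p \<noteq> 0" "\<partial>\<^sub>y n p \<noteq> 0"
proof -
  have "\<partial>\<^sub>x n p \<bullet> \<partial>\<^sub>x n p \<noteq> 0" "\<partial>\<^sub>y n p \<bullet> \<partial>\<^sub>y n p \<noteq> 0"
    unfolding partial_n_inner(2,3)[OF p] using U1_nz[OF p] by simp_all
  then show "\<partial>\<^sub>x n p \<noteq> 0" "\<partial>\<^sub>y n p \<noteq> 0" by auto
qed

lemma unit_normal_r: "unit_normal_on D r n"
  using smooth_n norm_n partial_r n_partial_n by (simp add: unit_normal_on_def)

lemma partial_A: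
  assumes "p \<in> D"
  shows "\<partial>\<^sub>x A p = l1 p * \<partial>\<^sub>x B p" "\<partial>\<^sub>y A p = l2 p * \<partial>\<^sub>y B p"
  using A U2 partial_B assms by simp_all

lemma partial_V32:
  assumes "p \<in> D"
  shows "\<partial>\<^sub>x V32 p = l1 p * \<partial>\<^sub>x V31 p" "\<partial>\<^sub>y V32 p = l2 p * \<partial>\<^sub>y V31 p"
  using V31 V32 U2 assms by simp_all

text \<open>The partials of \<open>A\<close> and of \<open>V32\<close> are the same multiples
  \<open>l1\<close>, \<open>l2\<close> of those of \<open>B\<close> and of \<open>V31\<close>. With
  these substituted into the quotient rule, the factor \<open>l1 B - A\<close> or
  \<open>l2 B - A\<close> splits off.\<close>

lemma partial_P:
  assumes "p \<in> D"
  shows "\<partial>\<^sub>x P p = \<rho>1 p * \<partial>\<^sub>x Q p" "\<partial>\<^sub>y P p = \<rho>2 p * \<partial>\<^sub>y Q p"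
  unfolding P_def[abs_def] Q_def[abs_def] \<rho>1_def \<rho>2_def using assms
  by (simp_all add: partial_diff partial_divide partial_mult diff partial_A partial_V32 field_simps)

lemma Q_nz: "p \<in> D \<Longrightarrow> Q p \<noteq> 0"
  by (simp add: Q_def V31_nz)

lemma P_eq: "p \<in> D \<Longrightarrow> P p = R p * Q p"
  by (simp add: P_def Q_def R_def v_def V31_nz field_simps)

text \<open>The product rule for \<open>P = R Q\<close>. Once \<open>Q = M . n\<close> and
  \<open>dQ = M . dn\<close> are known, these equations say that \<open>M\<close> is orthogonal to
  the partials of \<open>c\<close>.\<close>

lemma partial_R:
  assumes p: "p \<in> D"
  shows "Q p * \<partial>\<^sub>x R p = (\<rho>1 p - R p) * \<partial>\<^sub>x Q p" "Q p * \<partial>\<^sub>y R p = (\<rho>2 p - R p) * \<partial>\<^sub>y Q p"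
proof -
  have "\<partial>\<^sub>x P p = \<partial>\<^sub>x (\<lambda>q. R q * Q q) p" "\<partial>\<^sub>y P p = \<partial>\<^sub>y (\<lambda>q. R q * Q q) p"
    by (rule partial_cong[OF D p P_eq]; assumption)+
  then show "Q p * \<partial>\<^sub>x R p = (\<rho>1 p - R p) * \<partial>\<^sub>x Q p" "Q p * \<partial>\<^sub>y R p = (\<rho>2 p - R p) * \<partial>\<^sub>y Q p"
    using p by (simp_all add: partial_P partial_mult diff algebra_simps)
qed

lemma partial_c:
  assumes "p \<in> D"
  shows "\<partial>\<^sub>x c p = (\<rho>1 p - R p) *\<^sub>R \<partial>\<^sub>x n p - \<partial>\<^sub>x R p *\<^sub>R n p"
    "\<partial>\<^sub>y c p = (\<rho>2 p - R p) *\<^sub>R \<partial>\<^sub>y n p - \<partial>\<^sub>y R p *\<^sub>R n p"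
  unfolding c_def[abs_def] using assms
  by (simp_all add: partial_diff partial_scaleR diff partial_r algebra_simps)

section \<open>The direction \<open>M\<close> and the second envelope\<close>

lemma M_n: "M p \<bullet> n p = Q p"
proof -
  have "N p \<bullet> n p = 1 / B p"
    by (simp add: n_def inner_diff_right N_N N_k field_simps)
  moreover have "U3 p \<bullet> n p = (U1 p \<bullet> U3 p) / B p"
    using k by (simp add: n_def N_def inner_diff_right inner_add_right inner_commute field_simps)
  ultimately show ?thesis
    by (simp add: M_def Q_def inner_diff_left diff_divide_distrib)
qed

lemma M_nz: "p \<in> D \<Longrightarrow> M p \<noteq> 0"
  using M_n[of p] Q_nz[of p] by auto

text \<open>The partials of \<open>M\<close> are parallel to those of \<open>n\<close> and hence
  orthogonal to \<open>n\<close>, so only \<open>n\<close> contributes to the derivative of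
  \<open>M . n\<close>.\<close>

lemma partial_Q:
  assumes p: "p \<in> D"
  shows "\<partial>\<^sub>x Q p = \<partial>\<^sub>x n p \<bullet> M p" "\<partial>\<^sub>y Q p = \<partial>\<^sub>y n p \<bullet> M p"
proof -
  have "Q = (\<lambda>q. M q \<bullet> n q)"
    by (simp add: M_n)
  then show "\<partial>\<^sub>x Q p = \<partial>\<^sub>x n p \<bullet> M p" "\<partial>\<^sub>y Q p = \<partial>\<^sub>y n p \<bullet> M p"
    using p n_partial_n[OF p]
    by (simp_all add: partial_inner diff partial_M inner_commute)
qed

text \<open>Covers the second envelope, with \<open>X = r\<close> and \<open>f = P\<close>, and its
  normal, with \<open>X = n\<close>, \<open>f = Q\<close> and \<open>t = 1\<close>. As
  \<open>dX\<close>, \<open>dM\<close> and \<open>df\<close> are all governed by \<open>dn\<close>,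
  the coefficient of \<open>M\<close> in the derivative is \<open>- 2 (dn . M) / (M . M)\<close>
  times that of \<open>dn\<close>, as in a reflection.\<close>

lemma partial_reflected:
  assumes X: "smooth_on D X" and f: "smooth_on D f" and p: "p \<in> D"
  shows "\<partial>\<^sub>x X p = t *\<^sub>R \<partial>\<^sub>x n p \<Longrightarrow> \<partial>\<^sub>x f p = t * \<partial>\<^sub>x Q p \<Longrightarrow>
      \<partial>\<^sub>x (\<lambda>q. X q - (2 * f q / (M q \<bullet> M q)) *\<^sub>R M q) p =
      (t - 2 * f p * \<mu>1 p / (M p \<bullet> M p)) *\<^sub>R reflect (M p) (\<partial>\<^sub>x n p)"
    and "\<partial>\<^sub>y X p = t *\<^sub>R \<partial>\<^sub>y n p \<Longrightarrow> \<partial>\<^sub>y f p = t * \<partial>\<^sub>y Q p \<Longrightarrow>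
      \<partial>\<^sub>y (\<lambda>q. X q - (2 * f q / (M q \<bullet> M q)) *\<^sub>R M q) p =
      (t - 2 * f p * \<mu>2 p / (M p \<bullet> M p)) *\<^sub>R reflect (M p) (\<partial>\<^sub>y n p)"
proof -
  note d = smooth_on_differentiable[OF X p] smooth_on_differentiable[OF f p] diff[OF p]
  have mm: "M p \<bullet> M p \<noteq> 0" using M_nz[OF p] by simp
  have alg: "t *\<^sub>R a - ((2 * fp / w) *\<^sub>R (\<mu> *\<^sub>R a) +
        (((2 * (t * s)) * w - 2 * fp * (\<mu> * s + \<mu> * s)) / (w * w)) *\<^sub>R m) =
      (t - 2 * fp * \<mu> / w) *\<^sub>R (a - (2 * s / w) *\<^sub>R m)" if "w \<noteq> 0"
    for fp w \<mu> s :: real and a m :: "real^3"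
  proof -
    define K where "K = t - 2 * fp * \<mu> / w"
    have "((2 * (t * s)) * w - 2 * fp * (\<mu> * s + \<mu> * s)) / (w * w) = K * (2 * s / w)"
      using that by (simp add: K_def field_simps)
    moreover have "K *\<^sub>R a = t *\<^sub>R a - (2 * fp / w) *\<^sub>R (\<mu> *\<^sub>R a)"
      by (simp add: K_def scaleR_diff_left)
    ultimately show ?thesis
      unfolding K_def[symmetric] by (simp only: scaleR_diff_right) simp
  qed
  show "\<partial>\<^sub>x (\<lambda>q. X q - (2 * f q / (M q \<bullet> M q)) *\<^sub>R M q) p =
      (t - 2 * f p * \<mu>1 p / (M p \<bullet> M p)) *\<^sub>R reflect (M p) (\<partial>\<^sub>x n p)"
    if "\<partial>\<^sub>x X p = t *\<^sub>R \<partial>\<^sub>x n p" "\<partial>\<^sub>x f p = t * \<partial>\<^sub>x Q p"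
    using alg[OF mm, of "\<partial>\<^sub>x n p" "f p" "\<mu>1 p" "\<partial>\<^sub>x n p \<bullet> M p" "M p"] that mm
    by (simp add: d partial_diff partial_scaleR partial_divide partial_mult partial_inner
        partial_M[OF p] partial_Q[OF p] reflect_def inner_commute[of "M p" "\<partial>\<^sub>x n p"])
  show "\<partial>\<^sub>y (\<lambda>q. X q - (2 * f q / (M q \<bullet> M q)) *\<^sub>R M q) p =
      (t - 2 * f p * \<mu>2 p / (M p \<bullet> M p)) *\<^sub>R reflect (M p) (\<partial>\<^sub>y n p)"
    if "\<partial>\<^sub>y X p = t *\<^sub>R \<partial>\<^sub>y n p" "\<partial>\<^sub>y f p = t * \<partial>\<^sub>y Q p"
    using alg[OF mm, of "\<partial>\<^sub>y n p" "f p" "\<mu>2 p" "\<partial>\<^sub>y n p \<bullet> M p" "M p"] that mm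
    by (simp add: d partial_diff partial_scaleR partial_divide partial_mult partial_inner
        partial_M[OF p] partial_Q[OF p] reflect_def inner_commute[of "M p" "\<partial>\<^sub>y n p"])
qed

text \<open>On \<open>D\<close> this is where the line through \<open>r\<close> in the direction
  \<open>M\<close> meets the sphere again: \<open>R n + \<tau> M\<close> has length
  \<open>|R|\<close> exactly for \<open>\<tau> = 0\<close> and
  \<open>\<tau> = - 2 P / (M . M)\<close>.\<close>

definition "r' p = r p - (2 * P p / (M p \<bullet> M p)) *\<^sub>R M p"
definition "n' p = n p - (2 * Q p / (M p \<bullet> M p)) *\<^sub>R M p"

lemma n'_eq: "n' p = reflect (M p) (n p)"
  by (simp add: n'_def reflect_def M_n inner_commute[of "n p" "M p"])

lemma smooth': "smooth_on D r'" "smooth_on D n'"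
  unfolding r'_def[abs_def] n'_def[abs_def]
  by (intro smooth_intros D smooth_all; simp add: M_nz)+

lemma partial_r':
  assumes p: "p \<in> D"
  shows "\<partial>\<^sub>x r' p = (\<rho>1 p - 2 * P p * \<mu>1 p / (M p \<bullet> M p)) *\<^sub>R reflect (M p) (\<partial>\<^sub>x n p)"
    "\<partial>\<^sub>y r' p = (\<rho>2 p - 2 * P p * \<mu>2 p / (M p \<bullet> M p)) *\<^sub>R reflect (M p) (\<partial>\<^sub>y n p)"
  unfolding r'_def[abs_def]
  by (intro partial_reflected smooth_all p partial_r partial_P)+

lemma partial_n':
  assumes p: "p \<in> D"
  shows "\<partial>\<^sub>x n' p = (1 - 2 * Q p * \<mu>1 p / (M p \<bullet> M p)) *\<^sub>R reflect (M p) (\<partial>\<^sub>x n p)"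
  unfolding n'_def[abs_def]
  by (intro partial_reflected smooth_all p) simp_all

lemma unit_normal_r': "unit_normal_on D r' n'"
  unfolding unit_normal_on_def
proof (intro conjI ballI smooth')
  fix p assume p: "p \<in> D"
  show "norm (n' p) = 1"
    unfolding n'_eq norm_eq_1 inner_reflect by (rule n_n)
  show "n' p \<bullet> \<partial>\<^sub>x r' p = 0" "n' p \<bullet> \<partial>\<^sub>y r' p = 0"
    unfolding n'_eq partial_r'[OF p] inner_scaleR_right inner_reflect by (simp_all add: n_partial_n p)
qed

lemma curvature_coordinates_r:
  assumes p: "p \<in> D" and i: "immersed_at r p"
  shows "curvature_coordinates_at r p"
  using partial_n_inner(1)[OF p]
  by (intro curvature_coordinates_atI[OF D smooth_r unit_normal_r p _ _ i])
    (simp_all add: partial_r p inner_commute)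

lemma curvature_coordinates_r':
  assumes p: "p \<in> D" and i: "immersed_at r' p"
  shows "curvature_coordinates_at r' p"
  using partial_n_inner(1)[OF p]
  by (intro curvature_coordinates_atI[OF D smooth'(1) unit_normal_r' p _ _ i])
    (simp_all add: partial_r' partial_n' p inner_reflect inner_commute[of "\<partial>\<^sub>y n p"])

lemma r'_c: "p \<in> D \<Longrightarrow> r' p - c p = R p *\<^sub>R n' p"
  by (simp add: r'_def c_def n'_def P_eq algebra_simps)

lemma envelope_r: "envelope D c R r"
  using unit_normal_r smooth_r by (simp add: envelope_def unit_normal_on_def c_def)

lemma envelope_r': "envelope D c R r'"
  using unit_normal_r' smooth' r'_c by (simp add: envelope_def unit_normal_on_def)

section \<open>Uniqueness of the second envelope and the Ribaucour property\<close>

context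
  assumes R_nz: "\<And>p. p \<in> D \<Longrightarrow> R p \<noteq> 0"
    and R_neq: "\<And>p. p \<in> D \<Longrightarrow> R p \<noteq> \<rho>1 p" "\<And>p. p \<in> D \<Longrightarrow> R p \<noteq> \<rho>2 p"
begin

lemma second_envelope_r': "second_envelope D c R r r'"
  unfolding second_envelope_def
proof (intro conjI ballI envelope_r')
  fix p assume p: "p \<in> D"
  show "r' p \<noteq> r p"
    using M_nz[OF p] R_nz[OF p] Q_nz[OF p] by (simp add: r'_def P_eq[OF p])
qed

text \<open>Needed because the Ribaucour condition speaks of every second envelope. Tangency turns
  the derivative of \<open>|Y - c|^2 = R^2\<close> into linear equations for \<open>Y - c\<close>,
  which \<open>r - c\<close> also satisfies; as \<open>R\<close> differs from both principal radii,
  they fix \<open>Y - r\<close> up to a multiple of \<open>M\<close>.\<close>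

lemma second_envelope_unique:
  assumes Y: "second_envelope D c R r Y" and p: "p \<in> D"
  shows "Y p = r' p"
proof -
  have sY: "smooth_on D Y"
    and e: "norm (Y q - c q) = \<bar>R q\<bar>" "(Y q - c q) \<bullet> \<partial>\<^sub>x Y q = 0" "(Y q - c q) \<bullet> \<partial>\<^sub>y Y q = 0" "Y q \<noteq> r q"
    if "q \<in> D" for q
    using Y p that by (auto simp: second_envelope_def envelope_def)
  have sq: "(Y q - c q) \<bullet> (Y q - c q) = R q * R q" if "q \<in> D" for q
    using e(1)[OF that] by (metis norm_eq_square abs_ge_zero abs_mult_self_eq power2_eq_square)
  note dd = smooth_on_differentiable[OF sY[OF p] p] diff[OF p]
  have "\<partial>\<^sub>x (\<lambda>q. (Y q - c q) \<bullet> (Y q - c q)) p = \<partial>\<^sub>x (\<lambda>q. R q * R q) p"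
    "\<partial>\<^sub>y (\<lambda>q. (Y q - c q) \<bullet> (Y q - c q)) p = \<partial>\<^sub>y (\<lambda>q. R q * R q) p"
    by (rule partial_cong[OF D p sq]; assumption)+
  then have Yc: "(Y p - c p) \<bullet> \<partial>\<^sub>x c p = - (R p * \<partial>\<^sub>x R p)" "(Y p - c p) \<bullet> \<partial>\<^sub>y c p = - (R p * \<partial>\<^sub>y R p)"
    using e(2,3)[OF p]
    by (simp_all add: partial_inner partial_mult partial_diff dd inner_diff_right[of "Y p - c p"]
        inner_commute[of "\<partial>\<^sub>x _ p - _" "Y p - c p"] inner_commute[of "\<partial>\<^sub>y _ p - _" "Y p - c p"])
  define d where "d = Y p - r p"
  have Y_eq: "Y p - c p = d + R p *\<^sub>R n p"
    by (simp add: d_def c_def)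
  have dc: "(\<rho>1 p - R p) * (d \<bullet> \<partial>\<^sub>x n p) = \<partial>\<^sub>x R p * (d \<bullet> n p)"
    "(\<rho>2 p - R p) * (d \<bullet> \<partial>\<^sub>y n p) = \<partial>\<^sub>y R p * (d \<bullet> n p)"
    using Yc n_partial_n[OF p] n_n[of p] unfolding Y_eq partial_c[OF p]
    by (simp_all add: inner_add_left inner_diff_right distrib_left)
  \<comment> \<open>The only possible factor, by comparing components along \<open>n\<close>, since
    \<open>M . n = Q\<close>.\<close>
  define \<tau> where "\<tau> = (d \<bullet> n p) / Q p"
  have "d - \<tau> *\<^sub>R M p = 0"
  proof (rule orthogonal_to_frame_eq_0[of "\<partial>\<^sub>x n p" "\<partial>\<^sub>y n p" "n p"])
    have "(\<rho>1 p - R p) * ((d - \<tau> *\<^sub>R M p) \<bullet> \<partial>\<^sub>x n p) = \<partial>\<^sub>x R p * (d \<bullet> n p) - \<tau> * ((\<rho>1 p - R p) * \<partial>\<^sub>x Q p)"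
      using dc(1) partial_Q(1)[OF p] by (simp add: inner_diff_left inner_commute[of "M p" "\<partial>\<^sub>x n p"] algebra_simps)
    also have "\<dots> = 0"
      unfolding partial_R(1)[OF p, symmetric] \<tau>_def using Q_nz[OF p] by simp
    finally show "(d - \<tau> *\<^sub>R M p) \<bullet> \<partial>\<^sub>x n p = 0"
      using R_neq(1)[OF p] by simp
    have "(\<rho>2 p - R p) * ((d - \<tau> *\<^sub>R M p) \<bullet> \<partial>\<^sub>y n p) = \<partial>\<^sub>y R p * (d \<bullet> n p) - \<tau> * ((\<rho>2 p - R p) * \<partial>\<^sub>y Q p)"
      using dc(2) partial_Q(2)[OF p] by (simp add: inner_diff_left inner_commute[of "M p" "\<partial>\<^sub>y n p"] algebra_simps)
    also have "\<dots> = 0"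
      unfolding partial_R(2)[OF p, symmetric] \<tau>_def using Q_nz[OF p] by simp
    finally show "(d - \<tau> *\<^sub>R M p) \<bullet> \<partial>\<^sub>y n p = 0"
      using R_neq(2)[OF p] by simp
    show "(d - \<tau> *\<^sub>R M p) \<bullet> n p = 0"
      using Q_nz[OF p] by (simp add: inner_diff_left M_n \<tau>_def)
  qed (use p in \<open>simp_all add: partial_n_nz norm_n partial_n_inner n_partial_n\<close>)
  then have d: "d = \<tau> *\<^sub>R M p" by simp
  have "\<tau> \<noteq> 0" using e(4)[OF p] d by (auto simp: d_def)
  have "(d + R p *\<^sub>R n p) \<bullet> (d + R p *\<^sub>R n p) = R p * R p"
    using sq[OF p] unfolding Y_eq .
  \<comment> \<open>The root zero belongs to \<open>r\<close> itself and is excluded by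
    \<open>Y p \<noteq> r p\<close>.\<close>
  then have "\<tau> * (\<tau> * (M p \<bullet> M p) + 2 * P p) = 0"
    unfolding d by (simp add: inner_add_left inner_add_right M_n n_n P_eq[OF p] inner_commute[of "n p" "M p"] algebra_simps)
  then have "\<tau> * (M p \<bullet> M p) = - (2 * P p)"
    using \<open>\<tau> \<noteq> 0\<close> by simp
  then have "\<tau> = - (2 * P p / (M p \<bullet> M p))"
    using M_nz[OF p] by (simp add: field_simps)
  then show ?thesis
    using d by (simp add: d_def r'_def algebra_simps)
qed

lemma ribaucour:
  assumes "\<And>p. p \<in> D \<Longrightarrow> immersed_at r p"
  shows "ribaucour_congruence D c R r"
  unfolding ribaucour_congruence_def
proof (intro conjI allI impI ballI)
  show "\<exists>Y. second_envelope D c R r Y"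
    using second_envelope_r' by blast
next
  fix Y p assume Y: "second_envelope D c R r Y" and p: "p \<in> D" and i: "immersed_at Y p"
  have eq: "\<And>q. q \<in> D \<Longrightarrow> Y q = r' q"
    using second_envelope_unique[OF Y] .
  have sY: "smooth_on D Y"
    using Y by (simp add: second_envelope_def envelope_def)
  have pc: "\<partial>\<^sub>x Y q = \<partial>\<^sub>x r' q" "\<partial>\<^sub>y Y q = \<partial>\<^sub>y r' q" if "q \<in> D" for q
    using partial_cong[OF D that, of Y r'] eq by auto
  have fd: "frechet_derivative Y (at p) = frechet_derivative r' (at p)"
    using frechet_derivative_partials[OF smooth_on_differentiable[OF sY p]]
      frechet_derivative_partials[OF smooth_on_differentiable[OF smooth'(1) p]] pc[OF p]
    by (simp add: fun_eq_iff)
  have "\<partial>\<^sub>x (\<partial>\<^sub>y Y) p = \<partial>\<^sub>x (\<partial>\<^sub>y r') p"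
    by (rule partial_cong[OF D p pc(2)])
  then have "curvature_coordinates_at Y p \<longleftrightarrow> curvature_coordinates_at r' p"
    using fd pc[OF p] by (simp add: curvature_coordinates_at_def immersed_at_def gauss_normal_def)
  then show "curvature_coordinates_at Y p"
    using curvature_coordinates_r'[OF p] i fd by (simp add: immersed_at_def)
qed (use envelope_r curvature_coordinates_r assms in auto)

end

end

section \<open>The Lie image\<close>

definition lie_point :: "real^3 \<Rightarrow> real \<Rightarrow> real^5" where
  "lie_point c R = vector [c $ 1, c $ 2, c $ 3, (1 - c \<bullet> c + R\<^sup>2) / 2, (1 + c \<bullet> c - R\<^sup>2) / 2]"

text \<open>The differential of \<open>lie_point\<close> at \<open>(c, R)\<close> in the direction
  \<open>(a, b)\<close>. Its last two entries are opposite because those of \<open>lie_point\<close>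
  add up to 1.\<close>

definition lie_tangent :: "real^3 \<Rightarrow> real \<Rightarrow> real^3 \<Rightarrow> real \<Rightarrow> real^5" where
  "lie_tangent c R a b = vector [a $ 1, a $ 2, a $ 3, R * b - c \<bullet> a, c \<bullet> a - R * b]"

lemma affine_chart_hexaspherical:
  "affine_chart (hexaspherical c R) = inverse R *\<^sub>R lie_point c R"
  by (simp add: affine_chart_def hexaspherical_def lie_point_def vec_eq_iff forall_5
      divide_inverse[of _ R] mult.commute)

lemma smooth_on_lie_point:
  assumes "open D" "smooth_on D c" "smooth_on D R"
  shows "smooth_on D (\<lambda>q. lie_point (c q) (R q))"
proof (rule smooth_on_vec[OF assms(1)])
  fix i :: 5
  have "smooth_on D (\<lambda>q. (1 - c q \<bullet> c q + (R q)\<^sup>2) / 2)" "smooth_on D (\<lambda>q. (1 + c q \<bullet> c q - (R q)\<^sup>2) / 2)"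
    by (intro smooth_intros assms; simp)+
  then show "smooth_on D (\<lambda>q. lie_point (c q) (R q) $ i)"
    using exhaust_5[of i] smooth_on_nth[OF assms(1,2)] by (auto simp: lie_point_def)
qed

lemma partial_lie_point:
  assumes D: "open D" "smooth_on D c" "smooth_on D R" and p: "p \<in> D"
  shows "\<partial>\<^sub>x (\<lambda>q. lie_point (c q) (R q)) p = lie_tangent (c p) (R p) (\<partial>\<^sub>x c p) (\<partial>\<^sub>x R p)"
    "\<partial>\<^sub>y (\<lambda>q. lie_point (c q) (R q)) p = lie_tangent (c p) (R p) (\<partial>\<^sub>y c p) (\<partial>\<^sub>y R p)"
proof -
  note d = smooth_on_differentiable[OF D(2) p] smooth_on_differentiable[OF D(3) p]
  have L: "(\<lambda>q. lie_point (c q) (R q)) differentiable (at p)"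
    by (rule smooth_on_differentiable[OF smooth_on_lie_point[OF D] p])
  have "\<partial>\<^sub>x (\<lambda>q. lie_point (c q) (R q)) p $ i = lie_tangent (c p) (R p) (\<partial>\<^sub>x c p) (\<partial>\<^sub>x R p) $ i"
    "\<partial>\<^sub>y (\<lambda>q. lie_point (c q) (R q)) p $ i = lie_tangent (c p) (R p) (\<partial>\<^sub>y c p) (\<partial>\<^sub>y R p) $ i" for i
    unfolding partial_nth[OF L, symmetric] using exhaust_5[of i]
    by (auto simp: lie_point_def lie_tangent_def d partial_nth power2_eq_square
        partial_divide partial_add partial_diff partial_inner partial_mult
        inner_commute[of "\<partial>\<^sub>x c p"] inner_commute[of "\<partial>\<^sub>y c p"] field_simps)
  then show "\<partial>\<^sub>x (\<lambda>q. lie_point (c q) (R q)) p = lie_tangent (c p) (R p) (\<partial>\<^sub>x c p) (\<partial>\<^sub>x R p)"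
    "\<partial>\<^sub>y (\<lambda>q. lie_point (c q) (R q)) p = lie_tangent (c p) (R p) (\<partial>\<^sub>y c p) (\<partial>\<^sub>y R p)"
    by (simp_all add: vec_eq_iff)
qed

lemma lorentz_lie:
  "lorentz (lie_point c R) (lie_point c R) = R\<^sup>2"
  "lorentz (lie_point c R) (lie_tangent c R a b) = R * b"
  "lorentz (lie_tangent c R a b) (lie_tangent c R a' b') = a \<bullet> a'"
proof -
  have i: "u $ 1 * v $ 1 + u $ 2 * v $ 2 + u $ 3 * v $ 3 = u \<bullet> v" for u v :: "real^3"
    by (simp add: inner_vec_def sum_3)
  show "lorentz (lie_point c R) (lie_point c R) = R\<^sup>2"
    using i[of c c] by (simp add: lorentz_def lie_point_def) (simp add: field_simps power2_eq_square)
  show "lorentz (lie_point c R) (lie_tangent c R a b) = R * b"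
    using i[of c a] by (simp add: lorentz_def lie_point_def lie_tangent_def) (simp add: field_simps)
  show "lorentz (lie_tangent c R a b) (lie_tangent c R a' b') = a \<bullet> a'"
    using i[of a a'] by (simp add: lorentz_def lie_tangent_def) (simp add: field_simps)
qed

text \<open>The Lie metric on spheres, \<open>(dc . dc - dR^2) / R^2\<close>; the vectors paired are
  derivatives of \<open>lie_point / R\<close> by the quotient rule.\<close>

lemma lorentz_lie_chart:
  assumes "R \<noteq> 0"
  shows "lorentz (inverse R *\<^sub>R lie_tangent c R a b + (- (inverse R * inverse R * b)) *\<^sub>R lie_point c R)
      (inverse R *\<^sub>R lie_tangent c R a' b' + (- (inverse R * inverse R * b')) *\<^sub>R lie_point c R) =
    (a \<bullet> a' - b * b') / R\<^sup>2"
  using assms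
  by (simp add: lorentz.add_left lorentz.add_right lorentz.scaleR_left lorentz.scaleR_right
      lorentz.minus_left lorentz.minus_right lorentz.diff_left lorentz.diff_right
      lorentz_lie lorentz_commute[of "lie_tangent c R a b" "lie_point c R"]
      field_simps power2_eq_square)

lemma mixed_partial_mult:
  fixes f g :: "real \<times> real \<Rightarrow> real"
  assumes D: "open D" "smooth_on D f" "smooth_on D g" and p: "p \<in> D"
  shows "\<partial>\<^sub>y (\<partial>\<^sub>x (\<lambda>q. f q * g q)) p =
    \<partial>\<^sub>y (\<partial>\<^sub>x f) p * g p + \<partial>\<^sub>x f p * \<partial>\<^sub>y g p + \<partial>\<^sub>y f p * \<partial>\<^sub>x g p + f p * \<partial>\<^sub>y (\<partial>\<^sub>x g) p"
proof -
  note d = smooth_on_differentiable[OF D(2)] smooth_on_differentiable[OF D(3)]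
    smooth_on_differentiable[OF smooth_on_partial(1)[OF D(2)]]
    smooth_on_differentiable[OF smooth_on_partial(1)[OF D(3)]]
  have "\<partial>\<^sub>y (\<partial>\<^sub>x (\<lambda>q. f q * g q)) p = \<partial>\<^sub>y (\<lambda>q. f q * \<partial>\<^sub>x g q + \<partial>\<^sub>x f q * g q) p"
    by (rule partial_cong[OF D(1) p]) (simp add: partial_mult d)
  also have "\<dots> = \<partial>\<^sub>y (\<partial>\<^sub>x f) p * g p + \<partial>\<^sub>x f p * \<partial>\<^sub>y g p + \<partial>\<^sub>y f p * \<partial>\<^sub>x g p + f p * \<partial>\<^sub>y (\<partial>\<^sub>x g) p"
    using p by (simp add: partial_add partial_mult d)
  finally show ?thesis .
qed

section \<open>Metric and mixed derivative of the Lie image of the congruence\<close>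

context ribaucour_net
begin

text \<open>Since \<open>A + R = v B\<close>, the denominator \<open>B\<close> hidden in
  \<open>N\<close> cancels and the centre becomes affine in \<open>v\<close>.\<close>

lemma c_eq: "c p = U2 p - v p *\<^sub>R U1 p + (R p - v p) *\<^sub>R k"
proof -
  have "(A p + R p) *\<^sub>R N p = v p *\<^sub>R (U1 p + k)"
    by (simp add: R_def N_def)
  moreover have "c p = U2 p - (A p + R p) *\<^sub>R N p + R p *\<^sub>R k"
    by (simp add: c_def r_def n_def algebra_simps)
  ultimately show ?thesis by (simp add: algebra_simps)
qed

text \<open>The power of the origin with respect to the sphere. The terms quadratic in
  \<open>v\<close> cancel, so the last nonlinear coordinates are affine in \<open>v\<close> as
  well.\<close>

lemma c_power: "c p \<bullet> c p - (R p)\<^sup>2 = U2 p \<bullet> U2 p - 2 * v p * (U1 p \<bullet> U2 p - A p)"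
proof -
  have "c p \<bullet> c p = U2 p \<bullet> U2 p + (v p)\<^sup>2 * (U1 p \<bullet> U1 p) + (R p - v p)\<^sup>2 - 2 * v p * (U1 p \<bullet> U2 p)"
    unfolding c_eq using k
    by (simp add: inner_add_left inner_add_right inner_diff_left inner_diff_right
        inner_commute[of k "U1 p"] inner_commute[of k "U2 p"] inner_commute[of "U2 p" "U1 p"]
        power2_eq_square algebra_simps)
  then show ?thesis
    unfolding inner_U1_U1 R_def by (simp add: power2_eq_square algebra_simps)
qed

definition "F p = inverse (R p) *\<^sub>R lie_point (c p) (R p)"

context
  assumes R_nz: "\<And>p. p \<in> D \<Longrightarrow> R p \<noteq> 0"
    and R_neq: "\<And>p. p \<in> D \<Longrightarrow> R p \<noteq> \<rho>1 p" "\<And>p. p \<in> D \<Longrightarrow> R p \<noteq> \<rho>2 p"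
begin

lemma smooth_lie: "smooth_on D (\<lambda>q. lie_point (c q) (R q))"
  by (intro smooth_on_lie_point D smooth_all)

lemma smooth_F: "smooth_on D F"
  unfolding F_def[abs_def] by (intro smooth_intros smooth_on_inverse D smooth_all smooth_lie R_nz)

lemma partial_F:
  assumes p: "p \<in> D"
  shows "\<partial>\<^sub>x F p = inverse (R p) *\<^sub>R lie_tangent (c p) (R p) (\<partial>\<^sub>x c p) (\<partial>\<^sub>x R p)
      + (- (inverse (R p) * inverse (R p) * \<partial>\<^sub>x R p)) *\<^sub>R lie_point (c p) (R p)"
    "\<partial>\<^sub>y F p = inverse (R p) *\<^sub>R lie_tangent (c p) (R p) (\<partial>\<^sub>y c p) (\<partial>\<^sub>y R p)
      + (- (inverse (R p) * inverse (R p) * \<partial>\<^sub>y R p)) *\<^sub>R lie_point (c p) (R p)"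
  unfolding F_def[abs_def]
  using p R_nz[OF p] smooth_on_differentiable[OF smooth_lie p]
    partial_lie_point[OF D smooth_c smooth_R p]
  by (simp_all add: partial_scaleR partial_inverse diff)

text \<open>The component of \<open>dc\<close> along \<open>n\<close> is \<open>- dR\<close>, and it
  cancels against \<open>- dR^2\<close> in the Lie metric. What remains is the metric of the Gauss
  map, scaled in the two directions by the nonzero factors \<open>(\<rho>1 - R) / R\<close> and
  \<open>(\<rho>2 - R) / R\<close>.\<close>

lemma metric_F:
  assumes p: "p \<in> D"
  shows "lorentz (\<partial>\<^sub>x F p) (\<partial>\<^sub>y F p) = 0"
    "lorentz (\<partial>\<^sub>x F p) (\<partial>\<^sub>x F p) \<noteq> 0" "lorentz (\<partial>\<^sub>y F p) (\<partial>\<^sub>y F p) \<noteq> 0"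
proof -
  have g: "((s *\<^sub>R a - x *\<^sub>R n p) \<bullet> (t *\<^sub>R b - y *\<^sub>R n p) - x * y) = s * t * (a \<bullet> b)"
    if "n p \<bullet> a = 0" "n p \<bullet> b = 0" for a b s t x y
    using that n_n[of p]
    by (simp add: inner_diff_left inner_diff_right inner_commute[of a "n p"] algebra_simps)
  show "lorentz (\<partial>\<^sub>x F p) (\<partial>\<^sub>y F p) = 0"
    "lorentz (\<partial>\<^sub>x F p) (\<partial>\<^sub>x F p) \<noteq> 0" "lorentz (\<partial>\<^sub>y F p) (\<partial>\<^sub>y F p) \<noteq> 0"
    unfolding partial_F[OF p] lorentz_lie_chart[OF R_nz[OF p]] partial_c[OF p]
    using R_nz[OF p] R_neq[OF p] partial_n_nz[OF p] partial_n_inner(1)[OF p] n_partial_n[OF p]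
    by (simp_all add: g)
qed

lemma nondegenerate_F: "nondegenerate_surface D F"
  unfolding nondegenerate_surface_def
proof (intro conjI ballI smooth_F subsetI)
  fix u assume "u \<in> F ` D"
  then obtain p where p: "p \<in> D" and u: "u = F p" by blast
  show "u \<in> S31"
    using R_nz[OF p]
    by (simp add: u F_def S31_def lorentz.scaleR_left lorentz.scaleR_right lorentz_lie power2_eq_square
        field_simps)
next
  fix p assume "p \<in> D"
  then show "lorentz (\<partial>\<^sub>x F p) (\<partial>\<^sub>x F p) * lorentz (\<partial>\<^sub>y F p) (\<partial>\<^sub>y F p) - (lorentz (\<partial>\<^sub>x F p) (\<partial>\<^sub>y F p))\<^sup>2 \<noteq> 0"
    using metric_F by simp
qed

lemma partial_v:
  assumes "p \<in> D"
  shows "\<partial>\<^sub>x v p * V31 p = (l1 p - v p) * \<partial>\<^sub>x V31 p" "\<partial>\<^sub>y v p * V31 p = (l2 p - v p) * \<partial>\<^sub>y V31 p"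
  unfolding v_def[abs_def] using assms V31_nz[OF assms]
  by (simp_all add: partial_divide diff partial_V32 field_simps)

lemma v_neq: "p \<in> D \<Longrightarrow> l1 p - v p \<noteq> 0" "p \<in> D \<Longrightarrow> l2 p - v p \<noteq> 0"
  using R_neq[of p] by (auto simp: R_def \<rho>1_def \<rho>2_def)

text \<open>The mixed derivative is orthogonal to \<open>k\<close>, hence a combination of the two
  first partials, which span the plane orthogonal to \<open>k\<close>.\<close>

lemma U1_mixed:
  assumes p: "p \<in> D" and "\<Omega> \<bullet> \<partial>\<^sub>x U1 p = 0" "\<Omega> \<bullet> \<partial>\<^sub>y U1 p = 0"
  shows "\<Omega> \<bullet> \<partial>\<^sub>y (\<partial>\<^sub>x U1) p = 0"
proof -
  define w where "w = \<partial>\<^sub>y (\<partial>\<^sub>x U1) p"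
  define \<alpha> where "\<alpha> = (w \<bullet> \<partial>\<^sub>x U1 p) / (\<partial>\<^sub>x U1 p \<bullet> \<partial>\<^sub>x U1 p)"
  define \<beta> where "\<beta> = (w \<bullet> \<partial>\<^sub>y U1 p) / (\<partial>\<^sub>y U1 p \<bullet> \<partial>\<^sub>y U1 p)"
  have "\<partial>\<^sub>y (\<lambda>q. \<partial>\<^sub>x U1 q \<bullet> k) p = 0"
    using partial_cong(2)[OF D p, of "\<lambda>q. \<partial>\<^sub>x U1 q \<bullet> k" "\<lambda>q. 0"] partial_k by simp
  then have wk: "w \<bullet> k = 0"
    using smooth_on_differentiable[OF smooth_on_partial(1)[OF smooth_U(1)] p]
    by (simp add: partial_inner w_def)
  note o = U1_orth[OF p] inner_commute[of "\<partial>\<^sub>y U1 p" "\<partial>\<^sub>x U1 p"]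
    inner_commute[of k "\<partial>\<^sub>x U1 p"] inner_commute[of k "\<partial>\<^sub>y U1 p"]
  have "w - \<alpha> *\<^sub>R \<partial>\<^sub>x U1 p - \<beta> *\<^sub>R \<partial>\<^sub>y U1 p = 0"
    by (rule orthogonal_to_frame_eq_0[of "\<partial>\<^sub>x U1 p" "\<partial>\<^sub>y U1 p" k])
      (use U1_nz[OF p] k(1) wk o partial_k[OF p] in
        \<open>simp_all add: norm_eq_1 inner_diff_left \<alpha>_def \<beta>_def\<close>)
  then have "w = \<alpha> *\<^sub>R \<partial>\<^sub>x U1 p + \<beta> *\<^sub>R \<partial>\<^sub>y U1 p"
    by (simp add: algebra_simps)
  then show ?thesis
    unfolding w_def[symmetric] using assms by (simp add: inner_add_right)
qed

text \<open>The vector \<open>w\<close> is kept constant near \<open>p\<close>. Normality at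
  \<open>p\<close> says that its pairing \<open>f\<close> with \<open>F\<close> vanishes at
  \<open>p\<close> together with its gradient; the point is to get the mixed derivative as
  well.\<close>

lemma conjugate_F:
  assumes p: "p \<in> D" and w: "w \<in> normal_space F p"
  shows "lorentz w (\<partial>\<^sub>y (\<partial>\<^sub>x F) p) = 0"
proof -
  define w' :: "real^3" where "w' = vector [w $ 1, w $ 2, w $ 3]"
  \<comment> \<open>The fourth and fifth entries of a Lie point are \<open>(1 - t) / 2\<close> and
    \<open>(1 + t) / 2\<close> with \<open>t = c . c - R^2\<close>, so \<open>t\<close> enters the
    pairing with coefficient \<open>- s / 2\<close>.\<close>
  define s where "s = w $ 4 + w $ 5"
  \<comment> \<open>Inserting \<open>c_eq\<close> and \<open>c_power\<close> into the pairing gives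
    \<open>e2 - v e\<close>; the vector \<open>\<omega>\<close> is chosen such that
    \<open>de = \<omega> . dU1\<close>.\<close>
  define e where "e q = w' \<bullet> U1 q - (B q - 1) * (w' \<bullet> k) - s * (U1 q \<bullet> U2 q - A q)" for q
  define e2 where "e2 q = w' \<bullet> U2 q - A q * (w' \<bullet> k) + (w $ 4 - w $ 5) / 2 - s / 2 * (U2 q \<bullet> U2 q)" for q
  define f where "f q = lorentz w (F q)" for q
  define g where "g q = e2 q - v q * e q" for q
  define \<omega> where "\<omega> q = w' - (w' \<bullet> k) *\<^sub>R U1 q - s *\<^sub>R U2 q" for q
  have se: "smooth_on D e" "smooth_on D e2" "smooth_on D f" "smooth_on D \<omega>"
    unfolding e_def e2_def f_def \<omega>_def
    by (intro smooth_intros smooth_on_lorentz smooth_F D smooth_all; simp)+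
  have sg: "smooth_on D g"
    unfolding g_def by (intro smooth_intros se D smooth_all)
  note sd = smooth_on_differentiable
  have L: "lorentz w (lie_point (c q) (R q)) = g q" for q
  proof -
    have "lorentz w (lie_point (c q) (R q)) =
        w' \<bullet> c q + (w $ 4 - w $ 5) / 2 - s / 2 * (c q \<bullet> c q - (R q)\<^sup>2)"
      by (simp add: lorentz_def lie_point_def w'_def s_def inner_vec_def sum_3 field_simps)
    also have "w' \<bullet> c q = w' \<bullet> U2 q - v q * (w' \<bullet> U1 q) + (v q * B q - A q - v q) * (w' \<bullet> k)"
      unfolding c_eq R_def by (simp add: inner_add_right inner_diff_right)
    finally show ?thesis
      unfolding c_power by (simp add: g_def e_def e2_def algebra_simps)
  qed
  have gf: "R q * f q = g q" if "q \<in> D" for q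
    using R_nz[OF that] unfolding L[symmetric] f_def F_def by (simp add: lorentz.scaleR_right)
  have fx: "\<partial>\<^sub>x f q = lorentz w (\<partial>\<^sub>x F q)" "\<partial>\<^sub>y f q = lorentz w (\<partial>\<^sub>y F q)" if "q \<in> D" for q
    unfolding f_def using sd[OF smooth_F that] by (simp_all add: partial_lorentz lorentz.zero_left)
  have "\<partial>\<^sub>y (\<partial>\<^sub>x f) p = \<partial>\<^sub>y (\<lambda>q. lorentz w (\<partial>\<^sub>x F q)) p"
    by (rule partial_cong(2)[OF D p fx(1)])
  then have fxy: "\<partial>\<^sub>y (\<partial>\<^sub>x f) p = lorentz w (\<partial>\<^sub>y (\<partial>\<^sub>x F) p)"
    using sd[OF smooth_on_partial(1)[OF smooth_F] p]
    by (simp add: partial_lorentz lorentz.zero_left)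
  have f0: "f p = 0" "\<partial>\<^sub>x f p = 0" "\<partial>\<^sub>y f p = 0"
    using w p by (simp_all add: normal_space_def f_def[of p] fx)
  have "\<partial>\<^sub>x g p = \<partial>\<^sub>x (\<lambda>q. R q * f q) p" "\<partial>\<^sub>y g p = \<partial>\<^sub>y (\<lambda>q. R q * f q) p"
    by (rule partial_cong[OF D p gf[symmetric]]; assumption)+
  then have g0: "\<partial>\<^sub>x g p = 0" "\<partial>\<^sub>y g p = 0"
    using f0 sd[OF se(3) p] diff[OF p]
    by (simp_all add: partial_mult)
  \<comment> \<open>At \<open>p\<close> only the term of the product rule with both derivatives on
    \<open>f\<close> survives.\<close>
  have "\<partial>\<^sub>y (\<partial>\<^sub>x g) p = \<partial>\<^sub>y (\<partial>\<^sub>x (\<lambda>q. R q * f q)) p"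
    by (rule partial_cong(2)[OF D p], rule partial_cong(1)[OF D], assumption, rule gf[symmetric])
  then have gxy: "\<partial>\<^sub>y (\<partial>\<^sub>x g) p = R p * lorentz w (\<partial>\<^sub>y (\<partial>\<^sub>x F) p)"
    unfolding mixed_partial_mult[OF D smooth_R se(3) p] using f0 fxy by simp

  have e: "\<partial>\<^sub>x e q = \<omega> q \<bullet> \<partial>\<^sub>x U1 q" "\<partial>\<^sub>y e q = \<omega> q \<bullet> \<partial>\<^sub>y U1 q" if "q \<in> D" for q
    unfolding e_def \<omega>_def using that
    by (simp_all add: partial_diff partial_mult partial_inner diff partial_B A inner_diff_left
        inner_commute[of "U2 q"])
  have e2: "\<partial>\<^sub>x e2 q = l1 q * \<partial>\<^sub>x e q" "\<partial>\<^sub>y e2 q = l2 q * \<partial>\<^sub>y e q" if "q \<in> D" for q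
    unfolding e[OF that] unfolding e2_def \<omega>_def using that
    by (simp_all add: partial_diff partial_add partial_mult partial_divide partial_inner diff A U2 inner_diff_left
        inner_commute[of "\<partial>\<^sub>x U1 q" "U2 q"] inner_commute[of "\<partial>\<^sub>y U1 q" "U2 q"] algebra_simps)
  have gx: "\<partial>\<^sub>x g q = (l1 q - v q) * \<partial>\<^sub>x e q - \<partial>\<^sub>x v q * e q"
    "\<partial>\<^sub>y g q = (l2 q - v q) * \<partial>\<^sub>y e q - \<partial>\<^sub>y v q * e q" if "q \<in> D" for q
    unfolding g_def using that
    by (simp_all add: partial_diff partial_mult diff sd[OF se(1)] sd[OF se(2)] e2 algebra_simps)

  \<comment> \<open>Along \<open>D\<close> the gradient of \<open>e - m V31\<close> is \<open>(\<omega> - m U3) \<bullet> dU1\<close>. It vanishes at \<open>p\<close>, and then so does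
    its mixed derivative, because \<open>d(\<omega> - m U3)\<close> is diagonal with respect to \<open>dU1\<close>.\<close>
  define m where "m = e p / V31 p"
  have em: "e p = m * V31 p"
    using V31_nz[OF p] by (simp add: m_def)
  \<comment> \<open>The vanishing gradient of \<open>g\<close> reads
    \<open>(l1 - v) e_x = v_x e\<close> and \<open>(l2 - v) e_y = v_y e\<close> at \<open>p\<close>.
    \<open>V31\<close> satisfies the same equations, and the factors \<open>l1 - v\<close>,
    \<open>l2 - v\<close> are nonzero.\<close>
  have em': "\<partial>\<^sub>x e p = m * \<partial>\<^sub>x V31 p" "\<partial>\<^sub>y e p = m * \<partial>\<^sub>y V31 p"
  proof -
    have "(l1 p - v p) * \<partial>\<^sub>x e p = (\<partial>\<^sub>x v p * V31 p) * m" "(l2 p - v p) * \<partial>\<^sub>y e p = (\<partial>\<^sub>y v p * V31 p) * m"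
      using g0 unfolding gx[OF p] em by simp_all
    then have "(l1 p - v p) * \<partial>\<^sub>x e p = (l1 p - v p) * (m * \<partial>\<^sub>x V31 p)"
      "(l2 p - v p) * \<partial>\<^sub>y e p = (l2 p - v p) * (m * \<partial>\<^sub>y V31 p)"
      unfolding partial_v[OF p] by (simp_all add: mult.commute)
    then show "\<partial>\<^sub>x e p = m * \<partial>\<^sub>x V31 p" "\<partial>\<^sub>y e p = m * \<partial>\<^sub>y V31 p"
      using v_neq[OF p] by simp_all
  qed
  note spx = smooth_on_partial(1)
  have exy: "\<partial>\<^sub>y (\<partial>\<^sub>x e) p = m * \<partial>\<^sub>y (\<partial>\<^sub>x V31) p"
  proof -
    have 1: "\<partial>\<^sub>y (\<partial>\<^sub>x e) p = \<omega> p \<bullet> \<partial>\<^sub>y (\<partial>\<^sub>x U1) p"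
    proof -
      have "\<partial>\<^sub>y (\<partial>\<^sub>x e) p = \<partial>\<^sub>y (\<lambda>q. \<omega> q \<bullet> \<partial>\<^sub>x U1 q) p"
        by (rule partial_cong[OF D p e(1)])
      also have "\<dots> = \<omega> p \<bullet> \<partial>\<^sub>y (\<partial>\<^sub>x U1) p + \<partial>\<^sub>y \<omega> p \<bullet> \<partial>\<^sub>x U1 p"
        by (simp add: partial_inner sd[OF se(4) p] sd[OF spx[OF smooth_U(1)] p])
      \<comment> \<open>The y-derivative of \<open>\<omega>\<close> is a combination of those of
        \<open>U1\<close> and \<open>U2\<close>, hence a multiple of \<open>U1_y\<close>.\<close>
      also have "\<partial>\<^sub>y \<omega> p \<bullet> \<partial>\<^sub>x U1 p = 0"
        unfolding \<omega>_def using p U1_orth[OF p]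
        by (simp add: partial_diff partial_scaleR diff U2 inner_diff_left
            inner_commute[of "\<partial>\<^sub>y U1 p" "\<partial>\<^sub>x U1 p"])
      finally show ?thesis by simp
    qed
    have 2: "\<partial>\<^sub>y (\<partial>\<^sub>x V31) p = U3 p \<bullet> \<partial>\<^sub>y (\<partial>\<^sub>x U1) p"
    proof -
      have "\<partial>\<^sub>y (\<partial>\<^sub>x V31) p = \<partial>\<^sub>y (\<lambda>q. U3 q \<bullet> \<partial>\<^sub>x U1 q) p"
        by (rule partial_cong[OF D p V31(1)])
      also have "\<dots> = U3 p \<bullet> \<partial>\<^sub>y (\<partial>\<^sub>x U1) p + \<partial>\<^sub>y U3 p \<bullet> \<partial>\<^sub>x U1 p"
        by (simp add: partial_inner diff[OF p] sd[OF spx[OF smooth_U(1)] p])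
      finally show ?thesis
        using U1_orth[OF p] by (simp add: U3 p inner_commute)
    qed
    have "(\<omega> p - m *\<^sub>R U3 p) \<bullet> \<partial>\<^sub>y (\<partial>\<^sub>x U1) p = 0"
      using em' unfolding e[OF p] V31[OF p]
      by (intro U1_mixed[OF p]) (simp_all add: inner_diff_left)
    then show ?thesis
      unfolding 1 2 by (simp add: inner_diff_left)
  qed
  \<comment> \<open>The equation for \<open>V31\<close> holds throughout \<open>D\<close> and may be
    differentiated. The mixed derivative of \<open>g\<close> is the same expression with
    \<open>e\<close> for \<open>V31\<close>, so at \<open>p\<close> it is \<open>m\<close> times
    zero.\<close>
  have "\<partial>\<^sub>y (\<lambda>q. \<partial>\<^sub>x v q * V31 q) p = \<partial>\<^sub>y (\<lambda>q. (l1 q - v q) * \<partial>\<^sub>x V31 q) p"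
    by (rule partial_cong(2)[OF D p partial_v(1)])
  then have vxy: "\<partial>\<^sub>y (\<partial>\<^sub>x v) p * V31 p + \<partial>\<^sub>x v p * \<partial>\<^sub>y V31 p =
      (\<partial>\<^sub>y l1 p - \<partial>\<^sub>y v p) * \<partial>\<^sub>x V31 p + (l1 p - v p) * \<partial>\<^sub>y (\<partial>\<^sub>x V31) p"
    by (simp add: partial_mult partial_diff diff[OF p] sd[OF spx[OF smooth_v] p]
        sd[OF spx[OF smooth_V(2)] p] algebra_simps)
  have "\<partial>\<^sub>y (\<partial>\<^sub>x g) p = \<partial>\<^sub>y (\<lambda>q. (l1 q - v q) * \<partial>\<^sub>x e q - \<partial>\<^sub>x v q * e q) p"
    by (rule partial_cong(2)[OF D p gx(1)])
  also have "\<dots> = (\<partial>\<^sub>y l1 p - \<partial>\<^sub>y v p) * \<partial>\<^sub>x e p + (l1 p - v p) * \<partial>\<^sub>y (\<partial>\<^sub>x e) p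
      - \<partial>\<^sub>y (\<partial>\<^sub>x v) p * e p - \<partial>\<^sub>x v p * \<partial>\<^sub>y e p"
    by (simp add: partial_add partial_mult partial_diff diff[OF p] sd[OF spx[OF smooth_v] p]
        sd[OF spx[OF se(1)] p] sd[OF se(1) p] algebra_simps)
  also have "\<dots> = m * ((\<partial>\<^sub>y l1 p - \<partial>\<^sub>y v p) * \<partial>\<^sub>x V31 p + (l1 p - v p) * \<partial>\<^sub>y (\<partial>\<^sub>x V31) p)
      - m * (\<partial>\<^sub>y (\<partial>\<^sub>x v) p * V31 p + \<partial>\<^sub>x v p * \<partial>\<^sub>y V31 p)"
    unfolding em em' exy by (simp add: algebra_simps)
  also have "\<dots> = 0"
    unfolding vxy by simp
  finally show ?thesis
    using gxy R_nz[OF p] by simp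
qed

lemma flat_F: "flat_normal_bundle D F"
proof -
  interpret orthogonal_net D F
    by unfold_locales (use D nondegenerate_F metric_F conjugate_F in auto)
  show ?thesis by (rule flat)
qed

end

end

theorem mainTheorem7:
  fixes D :: "(real \<times> real) set"
    and \<phi> \<kappa>1 s1 \<kappa>2 s2 \<kappa>3 s3 A V31 V32 B lam1 lam2 \<rho>1 \<rho>2 R P Q z1 z2 z3 z4 z5 z6
        :: "real \<times> real \<Rightarrow> real"
    and r n c :: "real \<times> real \<Rightarrow> real^3"
  assumes "open D" and "simply_connected D"
    and "smooth_on D \<phi>" and "\<And>p. p \<in> D \<Longrightarrow> sin (\<phi> p) * cos (\<phi> p) \<noteq> 0"
    and "is_solution D \<phi> \<kappa>1 s1" and "is_solution D \<phi> \<kappa>2 s2" and "is_solution D \<phi> \<kappa>3 s3"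
    and "\<And>p. p \<in> D \<Longrightarrow> \<partial>\<^sub>x s1 p \<noteq> 0" and "\<And>p. p \<in> D \<Longrightarrow> \<partial>\<^sub>y s1 p \<noteq> 0"
    and "is_potential D A \<kappa>1 \<kappa>2 s1 s2"
    and "is_potential D V31 \<kappa>3 \<kappa>1 s3 s1"
    and "is_potential D V32 \<kappa>3 \<kappa>2 s3 s2"
  defines "B \<equiv> \<lambda>p. ((\<kappa>1 p)\<^sup>2 + (s1 p)\<^sup>2 + 1) / 2"
    and "r \<equiv> \<lambda>p. vector [\<kappa>2 p - \<kappa>1 p * A p / B p, s2 p - s1 p * A p / B p, - A p / B p]"
    and "n \<equiv> \<lambda>p. vector [\<kappa>1 p / B p, s1 p / B p, 1 / B p - 1]"
    and "lam1 \<equiv> \<lambda>p. \<partial>\<^sub>x s2 p / \<partial>\<^sub>x s1 p"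
    and "lam2 \<equiv> \<lambda>p. \<partial>\<^sub>y s2 p / \<partial>\<^sub>y s1 p"
    and "\<rho>1 \<equiv> \<lambda>p. lam1 p * B p - A p"
    and "\<rho>2 \<equiv> \<lambda>p. lam2 p * B p - A p"
    and "R \<equiv> \<lambda>p. V32 p / V31 p * B p - A p"
    and "P \<equiv> \<lambda>p. V32 p - V31 p * A p / B p"
    and "Q \<equiv> \<lambda>p. V31 p / B p"
    and "c \<equiv> \<lambda>p. r p - R p *\<^sub>R n p"
    and "z1 \<equiv> \<lambda>p. \<kappa>2 p - \<kappa>1 p * (V32 p / V31 p)"
    and "z2 \<equiv> \<lambda>p. s2 p - s1 p * (V32 p / V31 p)"
    and "z3 \<equiv> \<lambda>p. (B p - 1) * (V32 p / V31 p) - A p"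
    and "z4 \<equiv> \<lambda>p. (1 - (\<kappa>2 p)\<^sup>2 - (s2 p)\<^sup>2
                    + 2 * (\<kappa>1 p * \<kappa>2 p + s1 p * s2 p - A p) * (V32 p / V31 p)) / 2"
    and "z5 \<equiv> \<lambda>p. (1 + (\<kappa>2 p)\<^sup>2 + (s2 p)\<^sup>2
                    + 2 * (A p - \<kappa>1 p * \<kappa>2 p - s1 p * s2 p) * (V32 p / V31 p)) / 2"
    and "z6 \<equiv> \<lambda>p. B p * (V32 p / V31 p) - A p"
  assumes "\<And>p. p \<in> D \<Longrightarrow> immersed_at r p"
    and "\<And>p. p \<in> D \<Longrightarrow> V31 p \<noteq> 0"
    and "\<And>p. p \<in> D \<Longrightarrow> R p \<noteq> 0"
    and "\<And>p. p \<in> D \<Longrightarrow> R p \<noteq> \<rho>1 p"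
    and "\<And>p. p \<in> D \<Longrightarrow> R p \<noteq> \<rho>2 p"
  shows "(unit_normal_on D r n \<and>
          (\<forall>p\<in>D. \<partial>\<^sub>x r p = \<rho>1 p *\<^sub>R \<partial>\<^sub>x n p \<and> \<partial>\<^sub>y r p = \<rho>2 p *\<^sub>R \<partial>\<^sub>y n p)) \<and>
         (\<forall>p\<in>D. \<partial>\<^sub>x P p = \<rho>1 p * \<partial>\<^sub>x Q p \<and> \<partial>\<^sub>y P p = \<rho>2 p * \<partial>\<^sub>y Q p \<and> R p = P p / Q p) \<and>
         ribaucour_congruence D c R r \<and>
         (\<forall>p\<in>D. hexaspherical (c p) (R p) = vector [z1 p, z2 p, z3 p, z4 p, z5 p, z6 p] \<and>
                affine_chart (hexaspherical (c p) (R p)) =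
                  vector [z1 p / z6 p, z2 p / z6 p, z3 p / z6 p, z4 p / z6 p, z5 p / z6 p]) \<and>
         nondegenerate_surface D (\<lambda>p. affine_chart (hexaspherical (c p) (R p))) \<and>
         flat_normal_bundle D (\<lambda>p. affine_chart (hexaspherical (c p) (R p)))"
proof -
  define U where "U \<kappa> s p = (vector [\<kappa> p, s p, 0] :: real^3)" for \<kappa> s :: "real \<times> real \<Rightarrow> real" and p
  define k where "k = (vector [0, 0, 1] :: real^3)"
  have D: "open D" and V31_nz: "\<And>p. p \<in> D \<Longrightarrow> V31 p \<noteq> 0"
    and immersed: "\<And>p. p \<in> D \<Longrightarrow> immersed_at r p"
    by fact+
  have sol: "smooth_on D \<kappa>1" "smooth_on D s1" "smooth_on D \<kappa>2" "smooth_on D s2" "smooth_on D \<kappa>3" "smooth_on D s3"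
    using assms(5-7) by (simp_all add: is_solution_def)
  have pde: "\<partial>\<^sub>x \<kappa> p = tan (\<phi> p) * \<partial>\<^sub>x s p" "\<partial>\<^sub>y \<kappa> p = - cot (\<phi> p) * \<partial>\<^sub>y s p"
    if "is_solution D \<phi> \<kappa> s" "p \<in> D" for \<kappa> s p
    using that by (simp_all add: is_solution_def)
  have inner_U: "U \<kappa> s p \<bullet> U \<kappa>' s' q = \<kappa> p * \<kappa>' q + s p * s' q" for \<kappa> s \<kappa>' s' p q
    by (simp add: U_def inner_vec_def sum_3)
  have smooth_U: "smooth_on D (U \<kappa> s)" if "smooth_on D \<kappa>" "smooth_on D s" for \<kappa> s
  proof (rule smooth_on_vec[OF D])
    fix i :: 3
    show "smooth_on D (\<lambda>q. U \<kappa> s q $ i)"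
      using exhaust_3[of i] that by (auto simp: U_def smooth_on_const)
  qed
  have partial_U: "\<partial>\<^sub>x (U \<kappa> s) p = U (\<partial>\<^sub>x \<kappa>) (\<partial>\<^sub>x s) p" "\<partial>\<^sub>y (U \<kappa> s) p = U (\<partial>\<^sub>y \<kappa>) (\<partial>\<^sub>y s) p"
    if "smooth_on D \<kappa>" "smooth_on D s" "p \<in> D" for \<kappa> s p
  proof -
    note d = smooth_on_differentiable[OF smooth_U[OF that(1,2)] that(3)]
    have "\<partial>\<^sub>x (U \<kappa> s) p $ i = U (\<partial>\<^sub>x \<kappa>) (\<partial>\<^sub>x s) p $ i" "\<partial>\<^sub>y (U \<kappa> s) p $ i = U (\<partial>\<^sub>y \<kappa>) (\<partial>\<^sub>y s) p $ i" for i
      unfolding partial_nth[OF d, symmetric] using exhaust_3[of i] by (auto simp: U_def)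
    then show "\<partial>\<^sub>x (U \<kappa> s) p = U (\<partial>\<^sub>x \<kappa>) (\<partial>\<^sub>x s) p" "\<partial>\<^sub>y (U \<kappa> s) p = U (\<partial>\<^sub>y \<kappa>) (\<partial>\<^sub>y s) p"
      by (simp_all add: vec_eq_iff)
  qed
  have partial_V: "\<partial>\<^sub>x V p = U \<kappa> s p \<bullet> \<partial>\<^sub>x (U \<kappa>' s') p" "\<partial>\<^sub>y V p = U \<kappa> s p \<bullet> \<partial>\<^sub>y (U \<kappa>' s') p"
    if "is_potential D V \<kappa> \<kappa>' s s'" "smooth_on D \<kappa>'" "smooth_on D s'" "p \<in> D" for V \<kappa> \<kappa>' s s' p
    using that partial_eqI[of V _ p] unfolding is_potential_def partial_U[OF that(2-4)] inner_U
    by (auto simp: partial_x_def[of \<kappa>'] partial_y_def[of \<kappa>'] partial_x_def[of s'] partial_y_def[of s'])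
  \<comment> \<open>All solutions share the coefficients \<open>tan \<phi>\<close> and
    \<open>- cot \<phi>\<close>, so the derivative vectors in one coordinate direction are all
    parallel and compare by their second entries.\<close>
  have scale_U: "U (\<partial>\<^sub>x \<kappa>) (\<partial>\<^sub>x s) p = (\<partial>\<^sub>x s p / \<partial>\<^sub>x s1 p) *\<^sub>R U (\<partial>\<^sub>x \<kappa>1) (\<partial>\<^sub>x s1) p"
    "U (\<partial>\<^sub>y \<kappa>) (\<partial>\<^sub>y s) p = (\<partial>\<^sub>y s p / \<partial>\<^sub>y s1 p) *\<^sub>R U (\<partial>\<^sub>y \<kappa>1) (\<partial>\<^sub>y s1) p"
    if "is_solution D \<phi> \<kappa> s" "p \<in> D" for \<kappa> s p
    using pde[OF that] pde[OF assms(5) that(2)] assms(8,9)[OF that(2)]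
    by (simp_all add: U_def vec_eq_iff forall_3)
  interpret net: ribaucour_net D "U \<kappa>1 s1" "U \<kappa>2 s2" "U \<kappa>3 s3" k A V31 V32 lam1 lam2
    "\<lambda>p. \<partial>\<^sub>x s3 p / \<partial>\<^sub>x s1 p" "\<lambda>p. \<partial>\<^sub>y s3 p / \<partial>\<^sub>y s1 p"
  proof unfold_locales
    show "smooth_on D A" "smooth_on D V31" "smooth_on D V32"
      using assms(10-12) by (simp_all add: is_potential_def)
    show "smooth_on D lam1" "smooth_on D lam2"
      unfolding lam1_def lam2_def using assms(8,9) by (intro smooth_intros D sol; blast)+
    show "k \<bullet> k = 1" "U \<kappa>1 s1 p \<bullet> k = 0" "U \<kappa>2 s2 p \<bullet> k = 0" "U \<kappa>3 s3 p \<bullet> k = 0" for p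
      by (simp_all add: k_def U_def inner_vec_def sum_3)
  next
    fix p assume p: "p \<in> D"
    note scale_U[OF assms(6) p] scale_U[OF assms(7) p]
    then show "\<partial>\<^sub>x (U \<kappa>2 s2) p = lam1 p *\<^sub>R \<partial>\<^sub>x (U \<kappa>1 s1) p" "\<partial>\<^sub>y (U \<kappa>2 s2) p = lam2 p *\<^sub>R \<partial>\<^sub>y (U \<kappa>1 s1) p"
      "\<partial>\<^sub>x (U \<kappa>3 s3) p = (\<partial>\<^sub>x s3 p / \<partial>\<^sub>x s1 p) *\<^sub>R \<partial>\<^sub>x (U \<kappa>1 s1) p"
      "\<partial>\<^sub>y (U \<kappa>3 s3) p = (\<partial>\<^sub>y s3 p / \<partial>\<^sub>y s1 p) *\<^sub>R \<partial>\<^sub>y (U \<kappa>1 s1) p"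
      by (simp_all add: partial_U sol p lam1_def lam2_def)
    \<comment> \<open>The coefficients of the system multiply to -1, which makes the two partials of
      \<open>U \<kappa>1 s1\<close> orthogonal.\<close>
    have "tan (\<phi> p) * cot (\<phi> p) = 1"
      using assms(4)[OF p] by (auto simp: tan_def cot_def)
    then show "\<partial>\<^sub>x (U \<kappa>1 s1) p \<bullet> \<partial>\<^sub>y (U \<kappa>1 s1) p = 0"
      unfolding partial_U[OF sol(1,2) p] inner_U pde[OF assms(5) p] by algebra
    have "U (\<partial>\<^sub>x \<kappa>1) (\<partial>\<^sub>x s1) p $ 2 \<noteq> 0" "U (\<partial>\<^sub>y \<kappa>1) (\<partial>\<^sub>y s1) p $ 2 \<noteq> 0"
      using assms(8,9)[OF p] by (simp_all add: U_def)
    then show "\<partial>\<^sub>x (U \<kappa>1 s1) p \<noteq> 0" "\<partial>\<^sub>y (U \<kappa>1 s1) p \<noteq> 0"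
      unfolding partial_U[OF sol(1,2) p] by auto
  qed (use D assms(10-12) V31_nz in \<open>auto intro: smooth_U sol partial_V\<close>)
  have B: "net.B = B"
    by (simp add: fun_eq_iff net.B_def B_def inner_U power2_eq_square)
  have n: "net.n = n"
    unfolding fun_eq_iff net.n_def net.N_def B n_def
    by (simp add: U_def k_def vec_eq_iff forall_3 divide_inverse[of _ "B _"])
  have r: "net.r = r"
    unfolding fun_eq_iff net.r_def net.N_def B r_def
    by (simp add: U_def k_def vec_eq_iff forall_3 divide_inverse[of _ "B _"])
  have R: "net.R = R"
    by (simp add: fun_eq_iff net.R_def net.v_def B R_def)
  have c: "net.c = c"
    by (simp add: fun_eq_iff net.c_def c_def r n R)
  have P: "net.P = P" and Q: "net.Q = Q"
    by (simp_all add: fun_eq_iff net.P_def net.Q_def B P_def Q_def)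
  have \<rho>: "net.\<rho>1 = \<rho>1" "net.\<rho>2 = \<rho>2"
    by (simp_all add: fun_eq_iff net.\<rho>1_def net.\<rho>2_def B \<rho>1_def \<rho>2_def)
  have F: "net.F = (\<lambda>p. affine_chart (hexaspherical (c p) (R p)))"
    by (simp add: fun_eq_iff net.F_def c R affine_chart_hexaspherical)
  have R_nz: "\<And>p. p \<in> D \<Longrightarrow> net.R p \<noteq> 0" "\<And>p. p \<in> D \<Longrightarrow> net.R p \<noteq> net.\<rho>1 p"
    "\<And>p. p \<in> D \<Longrightarrow> net.R p \<noteq> net.\<rho>2 p"
    unfolding R \<rho> by fact+
  \<comment> \<open>The forms \<open>net.c_eq\<close> and \<open>net.c_power\<close>, free of
    \<open>1 / B\<close>, already are the stated coordinates.\<close>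
  have z: "hexaspherical (c p) (R p) = vector [z1 p, z2 p, z3 p, z4 p, z5 p, z6 p]" for p
  proof -
    have "c p $ 1 = z1 p" "c p $ 2 = z2 p" "c p $ 3 = z3 p"
      unfolding c[symmetric] net.c_eq
      by (simp_all add: R net.v_def U_def k_def z1_def z2_def z3_def R_def algebra_simps diff_divide_distrib)
    moreover have "(1 - c p \<bullet> c p + (R p)\<^sup>2) / 2 = z4 p" "(1 + c p \<bullet> c p - (R p)\<^sup>2) / 2 = z5 p"
    proof -
      define t where "t = V32 p / V31 p"
      have S: "c p \<bullet> c p = (R p)\<^sup>2 + (\<kappa>2 p)\<^sup>2 + (s2 p)\<^sup>2 - 2 * (\<kappa>1 p * \<kappa>2 p + s1 p * s2 p - A p) * t"
        using net.c_power[of p] unfolding c R inner_U net.v_def t_def[symmetric]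
        by (simp add: power2_eq_square algebra_simps)
      show "(1 - c p \<bullet> c p + (R p)\<^sup>2) / 2 = z4 p" "(1 + c p \<bullet> c p - (R p)\<^sup>2) / 2 = z5 p"
        unfolding S z4_def z5_def t_def[symmetric] by (simp_all add: algebra_simps)
    qed
    moreover have "R p = z6 p"
      by (simp add: R_def z6_def)
    ultimately show ?thesis
      by (simp add: hexaspherical_def)
  qed
  have i: "unit_normal_on D r n" "\<And>p. p \<in> D \<Longrightarrow> \<partial>\<^sub>x r p = \<rho>1 p *\<^sub>R \<partial>\<^sub>x n p \<and> \<partial>\<^sub>y r p = \<rho>2 p *\<^sub>R \<partial>\<^sub>y n p"
    using net.unit_normal_r net.partial_r by (simp_all add: r n \<rho>)
  have ii: "\<partial>\<^sub>x P p = \<rho>1 p * \<partial>\<^sub>x Q p \<and> \<partial>\<^sub>y P p = \<rho>2 p * \<partial>\<^sub>y Q p \<and> R p = P p / Q p" if "p \<in> D" for p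
    using net.partial_P[OF that] net.P_eq[OF that] net.Q_nz[OF that] by (simp add: P Q R \<rho>)
  have iii: "ribaucour_congruence D c R r"
    using net.ribaucour[OF R_nz] immersed by (simp add: c R r)
  have iv: "affine_chart (hexaspherical (c p) (R p)) =
      vector [z1 p / z6 p, z2 p / z6 p, z3 p / z6 p, z4 p / z6 p, z5 p / z6 p]" for p
    by (simp add: z affine_chart_def)
  show ?thesis
    using i ii iii z iv net.nondegenerate_F[OF R_nz] net.flat_F[OF R_nz] unfolding F by blast
qed

end
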